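(* Let $K$ be a field of characteristic $0$, let $L_{\infty}$ be a free Lie algebra over $K$ of countably infinite rank, and let $V$ be a proper fully invariant ideal of $L_{\infty}$ such that $L_{\infty}/V$ is nilpotent. Then every automorphism of $L_{\infty}/V$ lifts to an automorphism of $L_{\infty}$; that is, for every $\alpha\in\operatorname{Aut}(L_{\infty}/V)$ there exists $\phi\in\operatorname{Aut}(L_{\infty})$ such that $\pi_V\circ\phi=\alpha\circ\pi_V$, where $\pi_V\colon L_{\infty}\to L_{\infty}/V$ is the natural projection.
   Context: All Lie algebras are over $K$, and endomorphisms and automorphisms are $K$-linear Lie algebra maps. An ideal $V\subseteq L_{\infty}$ is fully invariant if $\varphi(V)\subseteq V$ for every endomorphism $\varphi$ of $L_{\infty}$. *)

theory Defs
  imports "HOL-Library.Countable_Set" "HOL-Algebra.QuotRing" "HOL-Algebra.Module" "HOL-Algebra.Algebraic_Closure_Type"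
begin

section \<open>Lie algebras over a field\<close>

text \<open>
  Scalars form a type of class \<^class>\<open>field\<close>; the carrier of a Lie algebra is a set.
  A Lie algebra is recorded in the HOL-Algebra record \<open>module\<close>, the product
  \<open>\<otimes>\<close> of the record being the Lie bracket. The \<open>one\<close> field of the record plays no role.
\<close>

abbreviation scalars :: "'k::field ring"
  where "scalars \<equiv> ring_of_type_algebra"

lemma scalars_simps [simp]:
  "carrier scalars = UNIV"
  "add scalars = (+)" "monoid.mult scalars = (*)"
  "ring.zero scalars = 0" "monoid.one scalars = 1"
  by (simp_all add: ring_of_type_algebra_def fun_eq_iff)

locale lie_algebra = module scalars L
  for L :: "('k::field, 'a) module" (structure) +
  assumes bracket_closed [simp, intro]:
      "\<lbrakk>x \<in> carrier L; y \<in> carrier L\<rbrakk> \<Longrightarrow> x \<otimes> y \<in> carrier L"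
    and bracket_add_left:
      "\<lbrakk>x \<in> carrier L; y \<in> carrier L; z \<in> carrier L\<rbrakk> \<Longrightarrow> (x \<oplus> y) \<otimes> z = x \<otimes> z \<oplus> y \<otimes> z"
    and bracket_add_right:
      "\<lbrakk>x \<in> carrier L; y \<in> carrier L; z \<in> carrier L\<rbrakk> \<Longrightarrow> x \<otimes> (y \<oplus> z) = x \<otimes> y \<oplus> x \<otimes> z"
    and bracket_smult_left:
      "\<lbrakk>x \<in> carrier L; y \<in> carrier L\<rbrakk> \<Longrightarrow> (c \<odot> x) \<otimes> y = c \<odot> (x \<otimes> y)"
    and bracket_smult_right:
      "\<lbrakk>x \<in> carrier L; y \<in> carrier L\<rbrakk> \<Longrightarrow> x \<otimes> (c \<odot> y) = c \<odot> (x \<otimes> y)"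
    and bracket_self:
      "x \<in> carrier L \<Longrightarrow> x \<otimes> x = \<zero>"
    and jacobi:
      "\<lbrakk>x \<in> carrier L; y \<in> carrier L; z \<in> carrier L\<rbrakk> \<Longrightarrow>
        x \<otimes> (y \<otimes> z) \<oplus> y \<otimes> (z \<otimes> x) \<oplus> z \<otimes> (x \<otimes> y) = \<zero>"

lemma lie_algebraI:
  fixes L :: "('k::field, 'a) module" (structure)
  assumes "\<zero> \<in> carrier L"
    "\<And>x y. \<lbrakk>x \<in> carrier L; y \<in> carrier L\<rbrakk> \<Longrightarrow> x \<oplus> y \<in> carrier L"
    "\<And>c x. x \<in> carrier L \<Longrightarrow> c \<odot> x \<in> carrier L"
    "\<And>x y. \<lbrakk>x \<in> carrier L; y \<in> carrier L\<rbrakk> \<Longrightarrow> x \<otimes> y \<in> carrier L"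
    "\<And>x y z. \<lbrakk>x \<in> carrier L; y \<in> carrier L; z \<in> carrier L\<rbrakk> \<Longrightarrow> (x \<oplus> y) \<oplus> z = x \<oplus> (y \<oplus> z)"
    "\<And>x y. \<lbrakk>x \<in> carrier L; y \<in> carrier L\<rbrakk> \<Longrightarrow> x \<oplus> y = y \<oplus> x"
    "\<And>x. x \<in> carrier L \<Longrightarrow> \<zero> \<oplus> x = x"
    "\<And>x. x \<in> carrier L \<Longrightarrow> (- 1) \<odot> x \<oplus> x = \<zero>"
    "\<And>c d x. x \<in> carrier L \<Longrightarrow> (c + d) \<odot> x = c \<odot> x \<oplus> d \<odot> x"
    "\<And>c x y. \<lbrakk>x \<in> carrier L; y \<in> carrier L\<rbrakk> \<Longrightarrow> c \<odot> (x \<oplus> y) = c \<odot> x \<oplus> c \<odot> y"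
    "\<And>c d x. x \<in> carrier L \<Longrightarrow> (c * d) \<odot> x = c \<odot> (d \<odot> x)"
    "\<And>x. x \<in> carrier L \<Longrightarrow> 1 \<odot> x = x"
    "\<And>x y z. \<lbrakk>x \<in> carrier L; y \<in> carrier L; z \<in> carrier L\<rbrakk> \<Longrightarrow>
      (x \<oplus> y) \<otimes> z = x \<otimes> z \<oplus> y \<otimes> z"
    "\<And>x y z. \<lbrakk>x \<in> carrier L; y \<in> carrier L; z \<in> carrier L\<rbrakk> \<Longrightarrow>
      x \<otimes> (y \<oplus> z) = x \<otimes> y \<oplus> x \<otimes> z"
    "\<And>c x y. \<lbrakk>x \<in> carrier L; y \<in> carrier L\<rbrakk> \<Longrightarrow> (c \<odot> x) \<otimes> y = c \<odot> (x \<otimes> y)"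
    "\<And>c x y. \<lbrakk>x \<in> carrier L; y \<in> carrier L\<rbrakk> \<Longrightarrow> x \<otimes> (c \<odot> y) = c \<odot> (x \<otimes> y)"
    "\<And>x. x \<in> carrier L \<Longrightarrow> x \<otimes> x = \<zero>"
    "\<And>x y z. \<lbrakk>x \<in> carrier L; y \<in> carrier L; z \<in> carrier L\<rbrakk> \<Longrightarrow>
      x \<otimes> (y \<otimes> z) \<oplus> y \<otimes> (z \<otimes> x) \<oplus> z \<otimes> (x \<otimes> y) = \<zero>"
  shows "lie_algebra L"
proof (intro lie_algebra.intro lie_algebra_axioms.intro moduleI cring_from_type_algebra
    abelian_groupI)
  show "\<exists>y\<in>carrier L. y \<oplus> x = \<zero>" if "x \<in> carrier L" for x
    using assms(3,8) that by blast
qed (unfold scalars_simps, (rule assms; assumption)+)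

context lie_algebra
begin

lemma smult_in [simp, intro]: "x \<in> carrier L \<Longrightarrow> c \<odot> x \<in> carrier L"
  using smult_closed[of c x] by simp

lemma smult_add_left: "x \<in> carrier L \<Longrightarrow> (c + d) \<odot> x = c \<odot> x \<oplus> d \<odot> x"
  using smult_l_distr[of c d x] by simp

lemma smult_add_right:
  "\<lbrakk>x \<in> carrier L; y \<in> carrier L\<rbrakk> \<Longrightarrow> c \<odot> (x \<oplus> y) = c \<odot> x \<oplus> c \<odot> y"
  using smult_r_distr[of c x y] by simp

lemma smult_smult: "x \<in> carrier L \<Longrightarrow> (c * d) \<odot> x = c \<odot> (d \<odot> x)"
  using smult_assoc1[of c d x] by simp

lemma smult_1: "x \<in> carrier L \<Longrightarrow> 1 \<odot> x = x"
  using smult_one[of x] by simp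

lemma smult_0: "x \<in> carrier L \<Longrightarrow> 0 \<odot> x = \<zero>"
  using smult_l_null[of x] by simp

lemma smult_minus_one: "x \<in> carrier L \<Longrightarrow> (- 1) \<odot> x \<oplus> x = \<zero>"
  using smult_add_left[of x "- 1" 1] by (simp add: smult_1 smult_0)

end

definition lie_hom ::
    "('k::field, 'a) module \<Rightarrow> ('k, 'b) module \<Rightarrow> ('a \<Rightarrow> 'b) set"
  where "lie_hom L M = {h \<in> carrier L \<rightarrow> carrier M.
    (\<forall>x\<in>carrier L. \<forall>y\<in>carrier L. h (x \<oplus>\<^bsub>L\<^esub> y) = h x \<oplus>\<^bsub>M\<^esub> h y) \<and>
    (\<forall>c. \<forall>x\<in>carrier L. h (c \<odot>\<^bsub>L\<^esub> x) = c \<odot>\<^bsub>M\<^esub> h x) \<and>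
    (\<forall>x\<in>carrier L. \<forall>y\<in>carrier L. h (x \<otimes>\<^bsub>L\<^esub> y) = h x \<otimes>\<^bsub>M\<^esub> h y)}"

lemma lie_hom_image_lie_algebra:
  assumes "lie_algebra L" and h: "h \<in> lie_hom L M"
    and M: "carrier M = h ` carrier L" and zM: "\<zero>\<^bsub>M\<^esub> = h \<zero>\<^bsub>L\<^esub>"
  shows "lie_algebra M"
proof -
  interpret lie_algebra L by fact
  have [simp]:
    "\<lbrakk>x \<in> carrier L; y \<in> carrier L\<rbrakk> \<Longrightarrow> h x \<oplus>\<^bsub>M\<^esub> h y = h (x \<oplus>\<^bsub>L\<^esub> y)"
    "x \<in> carrier L \<Longrightarrow> c \<odot>\<^bsub>M\<^esub> h x = h (c \<odot>\<^bsub>L\<^esub> x)"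
    "\<lbrakk>x \<in> carrier L; y \<in> carrier L\<rbrakk> \<Longrightarrow> h x \<otimes>\<^bsub>M\<^esub> h y = h (x \<otimes>\<^bsub>L\<^esub> y)" for x y c
    using h by (auto simp: lie_hom_def)
  show ?thesis
    apply (rule lie_algebraI)
                     apply (auto simp: M zM smult_minus_one smult_add_left smult_add_right
        smult_smult smult_1 bracket_add_left bracket_add_right bracket_smult_left
        bracket_smult_right bracket_self)
      apply (simp add: M.a_assoc)
     apply (simp add: M.a_comm)
    apply (simp add: jacobi)
    done
qed

abbreviation lie_end :: "('k::field, 'a) module \<Rightarrow> ('a \<Rightarrow> 'a) set"
  where "lie_end L \<equiv> lie_hom L L"

definition lie_aut :: "('k::field, 'a) module \<Rightarrow> ('a \<Rightarrow> 'a) set"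
  where "lie_aut L = {h \<in> lie_end L. bij_betw h (carrier L) (carrier L)}"

definition lie_ideal :: "'a set \<Rightarrow> ('k::field, 'a) module \<Rightarrow> bool"
  where "lie_ideal V L \<longleftrightarrow>
    submodule V scalars L \<and> (\<forall>x\<in>carrier L. \<forall>v\<in>V. x \<otimes>\<^bsub>L\<^esub> v \<in> V)"

definition fully_invariant :: "'a set \<Rightarrow> ('k::field, 'a) module \<Rightarrow> bool"
  where "fully_invariant V L \<longleftrightarrow> (\<forall>\<phi>\<in>lie_end L. \<phi> ` V \<subseteq> V)"

definition lie_quot :: "('k::field, 'a) module \<Rightarrow> 'a set \<Rightarrow> ('k, 'a set) module"
  where "lie_quot L V =
    \<lparr>carrier = a_rcosets\<^bsub>L\<^esub> V, monoid.mult = rcoset_mult L V, one = V +>\<^bsub>L\<^esub> \<one>\<^bsub>L\<^esub>,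
     ring.zero = V, add = set_add L, module.smult = (\<lambda>c A. \<Union>x\<in>A. V +>\<^bsub>L\<^esub> (c \<odot>\<^bsub>L\<^esub> x))\<rparr>"

definition lie_proj :: "('k::field, 'a) module \<Rightarrow> 'a set \<Rightarrow> 'a \<Rightarrow> 'a set"
  where "lie_proj L V x = V +>\<^bsub>L\<^esub> x"

definition lie_commutator ::
    "('k::field, 'a) module \<Rightarrow> 'a set \<Rightarrow> 'a set \<Rightarrow> 'a set"
  where "lie_commutator L A B =
    (\<lambda>W. submodule W scalars L) hull {x \<otimes>\<^bsub>L\<^esub> y | x y. x \<in> A \<and> y \<in> B}"

primrec lower_central :: "('k::field, 'a) module \<Rightarrow> nat \<Rightarrow> 'a set"
  where
    "lower_central L 0 = carrier L"
  | "lower_central L (Suc n) = lie_commutator L (lower_central L n) (carrier L)"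

definition lie_nilpotent :: "('k::field, 'a) module \<Rightarrow> bool"
  where "lie_nilpotent L \<longleftrightarrow> (\<exists>n. lower_central L n = {\<zero>\<^bsub>L\<^esub>})"


section \<open>Free Lie algebras\<close>

datatype ('k, 'x) lie_term =
    Gen 'x
  | Zero
  | Add "('k, 'x) lie_term" "('k, 'x) lie_term"
  | Smult 'k "('k, 'x) lie_term"
  | Bracket "('k, 'x) lie_term" "('k, 'x) lie_term"

text \<open>
  Freeness is the universal property. A definition cannot quantify over all types, so the
  test algebras \<open>M\<close> range over all Lie algebras whose carrier is a set of sets of Lie terms.
  This type is large enough: it contains a copy of \<open>L\<close> and the algebra of Lie terms modulo
  the Lie algebra identities. The lemma \<open>free_lie_basis_universal\<close> below derives the universal
  property for Lie algebras \<open>M\<close> on an arbitrary type.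
\<close>

definition free_lie_basis :: "('k::field, 'a) module \<Rightarrow> 'a set \<Rightarrow> bool"
  where "free_lie_basis L B \<longleftrightarrow> B \<subseteq> carrier L \<and>
    (\<forall>(M :: ('k, ('k, 'a) lie_term set) module) f. lie_algebra M \<longrightarrow> f \<in> B \<rightarrow> carrier M \<longrightarrow>
      (\<exists>h\<in>lie_hom L M. (\<forall>x\<in>B. h x = f x) \<and>
        (\<forall>h'\<in>lie_hom L M. (\<forall>x\<in>B. h' x = f x) \<longrightarrow> (\<forall>a\<in>carrier L. h' a = h a))))"


subsection \<open>The universal property for arbitrary types\<close>

inductive lie_eq :: "('k::field, 'x) lie_term \<Rightarrow> ('k, 'x) lie_term \<Rightarrow> bool"
  where
    lie_eq_refl: "lie_eq s s"
  | lie_eq_sym: "lie_eq s t \<Longrightarrow> lie_eq t s"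
  | lie_eq_trans: "lie_eq s t \<Longrightarrow> lie_eq t u \<Longrightarrow> lie_eq s u"
  | lie_eq_cong_add: "lie_eq s s' \<Longrightarrow> lie_eq t t' \<Longrightarrow> lie_eq (Add s t) (Add s' t')"
  | lie_eq_cong_smult: "lie_eq s s' \<Longrightarrow> lie_eq (Smult c s) (Smult c s')"
  | lie_eq_cong_bracket: "lie_eq s s' \<Longrightarrow> lie_eq t t' \<Longrightarrow> lie_eq (Bracket s t) (Bracket s' t')"
  | lie_eq_add_assoc: "lie_eq (Add (Add s t) u) (Add s (Add t u))"
  | lie_eq_add_comm: "lie_eq (Add s t) (Add t s)"
  | lie_eq_add_zero: "lie_eq (Add Zero s) s"
  | lie_eq_add_neg: "lie_eq (Add (Smult (- 1) s) s) Zero"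
  | lie_eq_smult_add_left: "lie_eq (Smult (c + d) s) (Add (Smult c s) (Smult d s))"
  | lie_eq_smult_add_right: "lie_eq (Smult c (Add s t)) (Add (Smult c s) (Smult c t))"
  | lie_eq_smult_smult: "lie_eq (Smult (c * d) s) (Smult c (Smult d s))"
  | lie_eq_smult_one: "lie_eq (Smult 1 s) s"
  | lie_eq_br_add_left: "lie_eq (Bracket (Add s t) u) (Add (Bracket s u) (Bracket t u))"
  | lie_eq_br_add_right: "lie_eq (Bracket s (Add t u)) (Add (Bracket s t) (Bracket s u))"
  | lie_eq_br_smult_left: "lie_eq (Bracket (Smult c s) t) (Smult c (Bracket s t))"
  | lie_eq_br_smult_right: "lie_eq (Bracket s (Smult c t)) (Smult c (Bracket s t))"
  | lie_eq_br_self: "lie_eq (Bracket s s) Zero"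
  | lie_eq_br_jacobi: "lie_eq (Add (Add (Bracket s (Bracket t u)) (Bracket t (Bracket u s)))
      (Bracket u (Bracket s t))) Zero"

definition cls :: "('k::field, 'x) lie_term \<Rightarrow> ('k, 'x) lie_term set"
  where "cls t = {s. lie_eq t s}"

definition rep :: "('k::field, 'x) lie_term set \<Rightarrow> ('k, 'x) lie_term"
  where "rep A = (SOME t. t \<in> A)"

lemma cls_eq_iff: "cls s = cls t \<longleftrightarrow> lie_eq s t"
  unfolding cls_def by (auto intro: lie_eq.intros)

lemma lie_eq_rep: "lie_eq t (rep (cls t))"
proof -
  have "t \<in> cls t" by (simp add: cls_def lie_eq_refl)
  then have "rep (cls t) \<in> cls t" unfolding rep_def by (rule someI)
  then show ?thesis by (simp add: cls_def)
qed

definition lie_terms_mod :: "('k::field, ('k, 'x) lie_term set) module"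
  where "lie_terms_mod =
    \<lparr>carrier = range cls, monoid.mult = (\<lambda>A B. cls (Bracket (rep A) (rep B))), one = cls Zero,
     ring.zero = cls Zero, add = (\<lambda>A B. cls (Add (rep A) (rep B))),
     module.smult = (\<lambda>c A. cls (Smult c (rep A)))\<rparr>"

lemma lie_terms_mod_simps [simp]:
  "carrier lie_terms_mod = range cls"
  "\<zero>\<^bsub>lie_terms_mod\<^esub> = cls Zero"
  "cls s \<oplus>\<^bsub>lie_terms_mod\<^esub> cls t = cls (Add s t)"
  "c \<odot>\<^bsub>lie_terms_mod\<^esub> cls s = cls (Smult c s)"
  "cls s \<otimes>\<^bsub>lie_terms_mod\<^esub> cls t = cls (Bracket s t)"
  by (auto simp: lie_terms_mod_def cls_eq_iff
      intro: lie_eq_cong_add lie_eq_cong_smult lie_eq_cong_bracket lie_eq_sym[OF lie_eq_rep])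

lemma lie_terms_mod_lie_algebra: "lie_algebra lie_terms_mod"
  by (rule lie_algebraI)
    (auto simp: cls_eq_iff del: equalityI intro: rangeI lie_eq_add_assoc lie_eq_add_comm
      lie_eq_add_zero lie_eq_add_neg lie_eq_smult_add_left lie_eq_smult_add_right
      lie_eq_smult_smult lie_eq_smult_one lie_eq_br_add_left lie_eq_br_add_right
      lie_eq_br_smult_left lie_eq_br_smult_right lie_eq_br_self lie_eq_br_jacobi)

primrec lie_eval :: "('k, 'b) module \<Rightarrow> ('x \<Rightarrow> 'b) \<Rightarrow> ('k, 'x) lie_term \<Rightarrow> 'b"
  where
    "lie_eval M f (Gen x) = f x"
  | "lie_eval M f Zero = \<zero>\<^bsub>M\<^esub>"
  | "lie_eval M f (Add s t) = lie_eval M f s \<oplus>\<^bsub>M\<^esub> lie_eval M f t"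
  | "lie_eval M f (Smult c s) = c \<odot>\<^bsub>M\<^esub> lie_eval M f s"
  | "lie_eval M f (Bracket s t) = lie_eval M f s \<otimes>\<^bsub>M\<^esub> lie_eval M f t"

context lie_algebra
begin

lemma lie_eval_closed: "(\<And>x. f x \<in> carrier L) \<Longrightarrow> lie_eval L f t \<in> carrier L"
  by (induction t) auto

lemma lie_eval_lie_eq:
  assumes f: "\<And>x. f x \<in> carrier L" and st: "lie_eq s t"
  shows "lie_eval L f s = lie_eval L f t"
proof -
  have [simp]: "lie_eval L f u \<in> carrier L" for u by (rule lie_eval_closed[OF f])
  from st show ?thesis
  proof induction
    case (lie_eq_add_assoc s t u)
    show ?case using M.a_assoc by simp
  next
    case (lie_eq_add_comm s t)
    show ?case using M.a_comm by simp
  next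
    case (lie_eq_br_jacobi s t u)
    show ?case using jacobi by simp
  qed (simp_all add: smult_minus_one smult_add_left smult_add_right smult_smult smult_1
      bracket_add_left bracket_add_right bracket_smult_left bracket_smult_right bracket_self)
qed

lemma lie_eval_rep_cls:
  "(\<And>x. f x \<in> carrier L) \<Longrightarrow> lie_eval L f (rep (cls t)) = lie_eval L f t"
  using lie_eval_lie_eq[OF _ lie_eq_rep] by metis

lemma lie_eval_hom:
  assumes f: "\<And>x. f x \<in> carrier L"
  shows "(\<lambda>A. lie_eval L f (rep A)) \<in> lie_hom lie_terms_mod L"
  by (auto simp: lie_hom_def lie_eval_rep_cls[OF f] lie_eval_closed[OF f])

lemma hom_eval:
  assumes "h \<in> lie_hom L M" "lie_algebra M" "\<And>x. f x \<in> carrier L"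
  shows "h (lie_eval L f t) = lie_eval M (h \<circ> f) t"
proof -
  have z: "h \<zero> \<in> carrier M" "h (0 \<odot> \<zero>) = 0 \<odot>\<^bsub>M\<^esub> h \<zero>"
    using assms(1) M.zero_closed unfolding lie_hom_def by blast+
  have "h \<zero> = h (0 \<odot> \<zero>)" by (simp add: smult_0)
  also have "\<dots> = \<zero>\<^bsub>M\<^esub>" using z lie_algebra.smult_0[OF assms(2)] by simp
  finally have z: "h \<zero> = \<zero>\<^bsub>M\<^esub>" .
  have "lie_eval L f u \<in> carrier L" for u by (rule lie_eval_closed[OF assms(3)])
  then show ?thesis using assms(1) z by (induction t) (simp_all add: lie_hom_def)
qed

end

lemma lie_hom_comp:
  "h \<in> lie_hom L M \<Longrightarrow> g \<in> lie_hom M N \<Longrightarrow> g \<circ> h \<in> lie_hom L N"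
  by (auto simp: lie_hom_def Pi_iff)

definition lie_copy :: "('a \<Rightarrow> 'b) \<Rightarrow> ('k, 'a) module \<Rightarrow> ('k, 'b) module"
  where "lie_copy i L =
    \<lparr>carrier = i ` carrier L, monoid.mult = (\<lambda>x y. i (inv_into UNIV i x \<otimes>\<^bsub>L\<^esub> inv_into UNIV i y)), one = i \<one>\<^bsub>L\<^esub>,
     ring.zero = i \<zero>\<^bsub>L\<^esub>, add = (\<lambda>x y. i (inv_into UNIV i x \<oplus>\<^bsub>L\<^esub> inv_into UNIV i y)),
     module.smult = (\<lambda>c x. i (c \<odot>\<^bsub>L\<^esub> inv_into UNIV i x))\<rparr>"

lemma lie_copy_hom:
  "inj i \<Longrightarrow> i \<in> lie_hom L (lie_copy i L)"
  by (auto simp: lie_hom_def lie_copy_def)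

lemma lie_copy_lie_algebra:
  "inj i \<Longrightarrow> lie_algebra L \<Longrightarrow> lie_algebra (lie_copy i L)"
  by (rule lie_hom_image_lie_algebra[OF _ lie_copy_hom]) (simp_all add: lie_copy_def)

theorem free_lie_basis_universal:
  fixes L :: "('k::field, 'a) module" and M :: "('k, 'b) module"
  assumes L: "lie_algebra L" and M: "lie_algebra M"
    and B: "free_lie_basis L B" and f: "f \<in> B \<rightarrow> carrier M"
  shows "\<exists>h\<in>lie_hom L M. (\<forall>x\<in>B. h x = f x) \<and>
    (\<forall>h'\<in>lie_hom L M. (\<forall>x\<in>B. h' x = f x) \<longrightarrow> (\<forall>a\<in>carrier L. h' a = h a))"
proof -
  interpret L: lie_algebra L by fact
  interpret M: lie_algebra M by fact
  have BL: "B \<subseteq> carrier L" using B by (simp add: free_lie_basis_def)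
  have U: "\<exists>h\<in>lie_hom L N. (\<forall>x\<in>B. h x = g x) \<and>
    (\<forall>h'\<in>lie_hom L N. (\<forall>x\<in>B. h' x = g x) \<longrightarrow> (\<forall>a\<in>carrier L. h' a = h a))"
    if "lie_algebra N" "g \<in> B \<rightarrow> carrier N"
    for N :: "('k, ('k, 'a) lie_term set) module" and g
    using B that unfolding free_lie_basis_def by blast
  have "(\<lambda>x. cls (Gen x)) \<in> B \<rightarrow> carrier lie_terms_mod" by simp
  from U[OF lie_terms_mod_lie_algebra this]
  obtain j where j: "j \<in> lie_hom L lie_terms_mod" "\<forall>x\<in>B. j x = cls (Gen x)"
    by (elim bexE conjE) (rule that)
  define f' where "f' x = (if x \<in> B then f x else \<zero>\<^bsub>M\<^esub>)" for x
  have f': "f' x \<in> carrier M" for x using f by (auto simp: f'_def)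
  define e where "e x = (if x \<in> B then x else \<zero>\<^bsub>L\<^esub>)" for x
  have e: "e x \<in> carrier L" for x using BL by (auto simp: e_def)
  define k where "k A = lie_eval L e (rep A)" for A
  have k: "k \<in> lie_hom lie_terms_mod L"
    using L.lie_eval_hom[OF e] by (simp add: k_def[abs_def])
  have kj: "k (j a) = a" if a: "a \<in> carrier L" for a
  proof -
    define i :: "'a \<Rightarrow> ('k, 'a) lie_term set" where "i b = {Gen b}" for b
    have i: "inj i" by (auto simp: inj_def i_def)
    have "i \<in> B \<rightarrow> carrier (lie_copy i L)" using BL by (auto simp: lie_copy_def)
    from U[OF lie_copy_lie_algebra[OF i L] this] obtain h where
      h: "\<forall>h'\<in>lie_hom L (lie_copy i L). (\<forall>x\<in>B. h' x = i x) \<longrightarrow> (\<forall>a\<in>carrier L. h' a = h a)"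
      by (elim bexE conjE) (rule that)
    have "i \<circ> (k \<circ> j) \<in> lie_hom L (lie_copy i L)"
      by (intro lie_hom_comp[OF lie_hom_comp[OF j(1) k]] lie_copy_hom i)
    moreover have "\<forall>x\<in>B. (i \<circ> (k \<circ> j)) x = i x"
      by (simp add: j k_def L.lie_eval_rep_cls[OF e]) (simp add: e_def)
    ultimately have "(i \<circ> (k \<circ> j)) a = h a" using bspec[OF h] a by blast
    moreover have "i a = h a" using bspec[OF h lie_copy_hom[OF i]] a by blast
    ultimately show ?thesis using injD[OF i] by simp
  qed
  show ?thesis
  proof (intro bexI conjI ballI impI)
    show h: "(\<lambda>A. lie_eval M f' (rep A)) \<circ> j \<in> lie_hom L M"
      by (rule lie_hom_comp[OF j(1) M.lie_eval_hom[OF f']])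
    show hB: "((\<lambda>A. lie_eval M f' (rep A)) \<circ> j) x = f x" if "x \<in> B" for x
      using that by (simp add: j(2) M.lie_eval_rep_cls[OF f']) (simp add: f'_def)
    fix h' a
    assume h': "h' \<in> lie_hom L M" and h'B: "\<forall>x\<in>B. h' x = f x" and a: "a \<in> carrier L"
    let ?h = "(\<lambda>A. lie_eval M f' (rep A)) \<circ> j"
    have zero: "g \<zero>\<^bsub>L\<^esub> = \<zero>\<^bsub>M\<^esub>" if "g \<in> lie_hom L M" for g
      using L.hom_eval[OF that M e, where t = Zero] by simp
    have "h' \<circ> e = ?h \<circ> e"
    proof
      fix x
      show "(h' \<circ> e) x = (?h \<circ> e) x"
        using hB[of x] h'B zero[OF h'] zero[OF h] by (simp add: e_def)
    qed
    then have "h' (lie_eval L e t) = ?h (lie_eval L e t)" for t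
      using L.hom_eval[OF h' M e, where t = t] L.hom_eval[OF h M e, where t = t] by simp
    from this[of "rep (j a)"] show "h' a = ?h a" using kj[OF a] by (simp add: k_def)
  qed
qed

lemma lie_terms_mod_free:
  "free_lie_basis (lie_terms_mod :: ('k::field, ('k, 'x) lie_term set) module)
    (range (\<lambda>x. cls (Gen x)))"
  unfolding free_lie_basis_def
proof (intro conjI allI impI)
  let ?F = "lie_terms_mod :: ('k, ('k, 'x) lie_term set) module"
  let ?g = "\<lambda>x. cls (Gen x) :: ('k, 'x) lie_term set"
  show "range ?g \<subseteq> carrier ?F" by auto
  fix M :: "('k, ('k, ('k, 'x) lie_term set) lie_term set) module" and f
  assume M: "lie_algebra M" and f: "f \<in> range ?g \<rightarrow> carrier M"
  interpret F: lie_algebra ?F by (rule lie_terms_mod_lie_algebra)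
  have fg: "(f \<circ> ?g) x \<in> carrier M" for x using f by auto
  have g: "?g x \<in> carrier ?F" for x by simp
  have cls: "cls t = lie_eval ?F ?g t" for t
    by (induction t) (simp_all flip: lie_terms_mod_simps)
  let ?h = "\<lambda>A. lie_eval M (f \<circ> ?g) (rep A)"
  have h: "?h (cls t) = lie_eval M (f \<circ> ?g) t" for t
    by (rule lie_algebra.lie_eval_rep_cls[OF M fg])
  show "\<exists>h\<in>lie_hom ?F M. (\<forall>x\<in>range ?g. h x = f x) \<and>
    (\<forall>h'\<in>lie_hom ?F M. (\<forall>x\<in>range ?g. h' x = f x) \<longrightarrow> (\<forall>a\<in>carrier ?F. h' a = h a))"
  proof (intro bexI[of _ ?h] conjI ballI impI)
    show "?h \<in> lie_hom ?F M" by (rule lie_algebra.lie_eval_hom[OF M fg])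
    show "?h x = f x" if "x \<in> range ?g" for x
    proof -
      from that obtain y where "x = ?g y" by (rule rangeE)
      then show ?thesis by (simp only: h lie_eval.simps comp_apply)
    qed
    fix h' a
    assume h': "h' \<in> lie_hom ?F M" "\<forall>x\<in>range ?g. h' x = f x" and "a \<in> carrier ?F"
    then obtain t where a: "a = cls t" by auto
    have "h' \<circ> ?g = f \<circ> ?g" using h'(2) by auto
    then have "h' (lie_eval ?F ?g t) = lie_eval M (f \<circ> ?g) t"
      using F.hom_eval[OF h'(1) M g, where t = t] by (simp only:)
    then show "h' a = ?h a"
      unfolding a h cls[of t, symmetric] .
  qed
qed


section \<open>The quotient by an ideal\<close>

context
  fixes L :: "('k::field, 'a) module" (structure) and V
  assumes L: "lie_algebra L" and V: "lie_ideal V L"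
begin

interpretation lie_algebra L by (rule L)

interpretation abelian_subgroup V L
  using V unfolding lie_ideal_def submodule_def
  by (intro abelian_subgroupI3 additive_subgroup.intro) (auto intro: M.abelian_group_axioms)

lemma ideal_in_carrier: "v \<in> V \<Longrightarrow> v \<in> carrier L"
  using a_subset by blast

lemma ideal_smult: "v \<in> V \<Longrightarrow> c \<odot> v \<in> V"
  using V submodule.smult_closed[of V scalars L c v] unfolding lie_ideal_def by auto

lemma ideal_bracket_right: "x \<in> carrier L \<Longrightarrow> v \<in> V \<Longrightarrow> x \<otimes> v \<in> V"
  using V unfolding lie_ideal_def by blast

lemma bracket_anticomm:
  assumes x: "x \<in> carrier L" and y: "y \<in> carrier L"
  shows "x \<otimes> y = (- 1) \<odot> (y \<otimes> x)"
proof -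
  have "\<zero> = (x \<oplus> y) \<otimes> (x \<oplus> y)" using x y bracket_self by simp
  also have "\<dots> = (x \<otimes> x \<oplus> y \<otimes> x) \<oplus> (x \<otimes> y \<oplus> y \<otimes> y)"
    using x y by (simp add: bracket_add_left bracket_add_right)
  also have "\<dots> = y \<otimes> x \<oplus> x \<otimes> y" using x y by (simp add: bracket_self)
  finally have 1: "x \<otimes> y \<oplus> y \<otimes> x = \<zero>" using x y M.a_comm by simp
  have 2: "(- 1) \<odot> (y \<otimes> x) \<oplus> y \<otimes> x = \<zero>" using x y smult_minus_one by simp
  show ?thesis using 1 2 x y by (metis M.add.r_cancel bracket_closed smult_in)
qed

lemma ideal_bracket_left: "x \<in> carrier L \<Longrightarrow> v \<in> V \<Longrightarrow> v \<otimes> x \<in> V"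
  using bracket_anticomm[of v x] ideal_in_carrier ideal_smult ideal_bracket_right by simp

lemma in_coset: "y \<in> V +> x \<longleftrightarrow> (\<exists>v\<in>V. y = v \<oplus> x)"
  by (auto simp: a_r_coset_def r_coset_def)

lemma coset_absorb: "x \<in> carrier L \<Longrightarrow> v \<in> V \<Longrightarrow> V +> (v \<oplus> x) = V +> x"
  using a_repr_independence'[of "v \<oplus> x" x] in_coset[of "v \<oplus> x" x]
    a_subgroup by metis

lemma lie_quot_carrier: "carrier (lie_quot L V) = lie_proj L V ` carrier L"
  by (auto simp: lie_quot_def lie_proj_def A_RCOSETS_def')

lemma lie_quot_zero: "\<zero>\<^bsub>lie_quot L V\<^esub> = lie_proj L V \<zero>"
  using a_subset by (simp add: lie_quot_def lie_proj_def)

lemma lie_quot_add: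
  "\<lbrakk>x \<in> carrier L; y \<in> carrier L\<rbrakk> \<Longrightarrow>
    lie_proj L V x \<oplus>\<^bsub>lie_quot L V\<^esub> lie_proj L V y = lie_proj L V (x \<oplus> y)"
  by (simp add: lie_quot_def lie_proj_def a_rcos_sum)

lemma lie_quot_smult:
  assumes x: "x \<in> carrier L"
  shows "c \<odot>\<^bsub>lie_quot L V\<^esub> lie_proj L V x = lie_proj L V (c \<odot> x)"
proof -
  have "V +> (c \<odot> y) = V +> (c \<odot> x)" if y: "y \<in> V +> x" for y
  proof -
    obtain v where v: "v \<in> V" "y = v \<oplus> x" using y in_coset by blast
    then have "c \<odot> y = c \<odot> v \<oplus> c \<odot> x"
      using smult_r_distr[of c v x] x ideal_in_carrier by simp
    then show ?thesis using coset_absorb ideal_smult v x by simp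
  qed
  then have "(\<Union>y\<in>V +> x. V +> (c \<odot> y)) = (\<Union>y\<in>V +> x. V +> (c \<odot> x))"
    by (rule SUP_cong[OF refl])
  moreover have "V +> x \<noteq> {}" using a_rcos_self[OF x] by blast
  ultimately show ?thesis
    unfolding lie_quot_def lie_proj_def module.simps by simp
qed

lemma lie_quot_bracket:
  assumes x: "x \<in> carrier L" and y: "y \<in> carrier L"
  shows "lie_proj L V x \<otimes>\<^bsub>lie_quot L V\<^esub> lie_proj L V y = lie_proj L V (x \<otimes> y)"
proof -
  have "V +> (a \<otimes> b) = V +> (x \<otimes> y)" if a: "a \<in> V +> x" and b: "b \<in> V +> y" for a b
  proof -
    obtain v where v: "v \<in> V" "a = v \<oplus> x" using a in_coset by blast
    obtain w where w: "w \<in> V" "b = w \<oplus> y" using b in_coset by blast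
    note vw = ideal_in_carrier[OF v(1)] ideal_in_carrier[OF w(1)]
    have "a \<otimes> b = v \<otimes> b \<oplus> x \<otimes> b" "x \<otimes> b = x \<otimes> w \<oplus> x \<otimes> y"
      using bracket_add_left[of v x b] bracket_add_right[of x w y] v w vw x y by simp_all
    moreover have "v \<otimes> b \<in> V" using v w vw y by (intro ideal_bracket_left) auto
    moreover have "x \<otimes> w \<in> V" using w x ideal_bracket_right by blast
    ultimately show ?thesis using x y vw coset_absorb by simp
  qed
  then have "(\<Union>a\<in>V +> x. \<Union>b\<in>V +> y. V +> (a \<otimes> b)) =
      (\<Union>a\<in>V +> x. \<Union>b\<in>V +> y. V +> (x \<otimes> y))"
    by (intro SUP_cong refl)
  moreover have "V +> x \<noteq> {}" "V +> y \<noteq> {}"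
    using a_rcos_self[OF x] a_rcos_self[OF y] by blast+
  ultimately show ?thesis
    unfolding lie_quot_def lie_proj_def rcoset_mult_def monoid.simps by simp
qed

lemma lie_proj_hom: "lie_proj L V \<in> lie_hom L (lie_quot L V)"
  by (auto simp: lie_hom_def lie_quot_carrier lie_quot_add lie_quot_smult lie_quot_bracket)

lemma lie_proj_eq_zero_iff:
  assumes x: "x \<in> carrier L"
  shows "lie_proj L V x = \<zero>\<^bsub>lie_quot L V\<^esub> \<longleftrightarrow> x \<in> V"
proof
  assume "lie_proj L V x = \<zero>\<^bsub>lie_quot L V\<^esub>"
  then show "x \<in> V" using a_rcos_self[OF x] by (simp add: lie_proj_def lie_quot_def)
next
  assume "x \<in> V"
  then show "lie_proj L V x = \<zero>\<^bsub>lie_quot L V\<^esub>"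
    using coset_absorb[of \<zero> x] x by (simp add: lie_quot_zero) (simp add: lie_proj_def)
qed

theorem lie_quot_lie_algebra: "lie_algebra (lie_quot L V)"
  by (rule lie_hom_image_lie_algebra[OF L lie_proj_hom lie_quot_carrier lie_quot_zero])

end

end

theory Submission
  imports Defs
begin

text \<open>
  Write \<open>\<gamma>\<^sub>n\<close> for the lower central series of the free Lie algebra \<open>L\<close>, with \<open>\<gamma>\<^sub>1 = L\<close>, and \<open>B\<close> for
  a countably infinite basis. A proper fully invariant ideal \<open>V\<close> lies in \<open>\<gamma>\<^sub>2\<close>: if an element of \<open>V\<close>
  involves a generator \<open>b\<close> in its linear part, the endomorphism that keeps \<open>b\<close> and kills the other
  generators shows \<open>b \<in> V\<close>, and then every endomorphism moving \<open>b\<close> shows \<open>V = L\<close>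
  (\<open>fully_invariant_subset_derived\<close>). Nilpotency of \<open>L/V\<close> means \<open>\<gamma>\<^sub>n \<subseteq> V\<close> for some \<open>n\<close>. By freeness,
  \<open>\<alpha>\<close> is induced by some endomorphism \<open>f\<close> of \<open>L\<close>, and \<open>f\<close> is invertible modulo \<open>\<gamma>\<^sub>2\<close>. So it is
  enough to find an automorphism of \<open>L\<close> that agrees with \<open>f\<close> modulo \<open>\<gamma>\<^sub>n\<close>.

  This is done by induction on \<open>n\<close>. Modulo \<open>\<gamma>\<^sub>2\<close> the linear part of \<open>f\<close> is an automorphism
  (\<open>linear_lift\<close>). If \<open>\<phi>\<close> is an automorphism that agrees with \<open>f\<close> modulo \<open>\<gamma>\<^sub>n\<close>, then
  \<open>\<phi>\<inverse> f\<close> sends each \<open>b \<in> B\<close> to \<open>b + u\<^sub>b\<close> with \<open>u\<^sub>b \<in> \<gamma>\<^sub>n\<close>, and \<open>\<phi>\<close> can be corrected once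
  the family \<open>u\<close> is \<^emph>\<open>realizable\<close>: some automorphism \<open>\<theta>\<close> of \<open>L\<close> satisfies
  \<open>\<theta> b \<equiv> b + u\<^sub>b\<close> modulo \<open>\<gamma>\<^bsub>n+1\<^esub>\<close> for all \<open>b \<in> B\<close>. The whole weight of the proof is on
  \<open>realizable_all\<close>: for \<open>n \<ge> 2\<close> every family with values in \<open>\<gamma>\<^sub>n\<close> is realizable.

  Realizable families are closed under sums, since automorphisms that are trivial modulo \<open>\<gamma>\<^sub>2\<close> act
  trivially on \<open>\<gamma>\<^sub>n/\<gamma>\<^bsub>n+1\<^esub>\<close>. A family supported on \<open>Y \<subseteq> B\<close> whose values avoid \<open>Y\<close> is realized by
  the evident elementary automorphism. The obstruction is a family with values that involve \<open>Y\<close>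
  itself, such as \<open>y \<mapsto> [y, z]\<close>; in finite rank it has a trace. In infinite rank a swindle removes
  it. Suppose infinitely many generators are unused, and let \<open>y\<^sub>0 = y, y\<^sub>1, y\<^sub>2, \<dots>\<close> be copies of the
  used generators among them. The family \<open>D\<close> with \<open>D(y\<^sub>i) = [y\<^bsub>i+1\<^esub>, z]\<close> is realizable, as it is a sum
  of two elementary families (even \<open>i\<close> and odd \<open>i\<close>), say by \<open>\<theta>\<close>. The automorphism \<open>g\<close> with
  \<open>y\<^sub>0 \<mapsto> y\<^sub>0\<close> and \<open>y\<^bsub>i+1\<^esub> \<mapsto> y\<^bsub>i+1\<^esub> + y\<^sub>i\<close> satisfies \<open>g D - D g = (y\<^sub>0 \<mapsto> [y\<^sub>0, z])\<close>, so the commutator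
  \<open>g\<inverse> \<theta>\<inverse> g \<theta>\<close> realizes the offending family (\<open>realizable_commutator\<close>). For a value with several
  entries from \<open>Y\<close> the swindle moves one entry at a time, and \<open>realizable_words\<close> is an induction on
  their number. Unused generators are provided by a pigeonhole argument: colour \<open>B\<close> with \<open>n + 2\<close>
  colours, each used infinitely often; a bracket of \<open>n\<close> generators together with the generator that
  it is assigned to misses a colour, so every family is a sum of \<open>n + 2\<close> families each missing one.
\<close>

section \<open>Homomorphisms\<close>

lemma lie_hom_closed: "h \<in> lie_hom L M \<Longrightarrow> x \<in> carrier L \<Longrightarrow> h x \<in> carrier M"
  by (auto simp: lie_hom_def)

lemma lie_hom_add:
  "h \<in> lie_hom L M \<Longrightarrow> x \<in> carrier L \<Longrightarrow> y \<in> carrier L \<Longrightarrow> h (x \<oplus>\<^bsub>L\<^esub> y) = h x \<oplus>\<^bsub>M\<^esub> h y"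
  by (auto simp: lie_hom_def)

lemma lie_hom_smult:
  "h \<in> lie_hom L M \<Longrightarrow> x \<in> carrier L \<Longrightarrow> h (c \<odot>\<^bsub>L\<^esub> x) = c \<odot>\<^bsub>M\<^esub> h x"
  by (auto simp: lie_hom_def)

lemma lie_hom_bracket:
  "h \<in> lie_hom L M \<Longrightarrow> x \<in> carrier L \<Longrightarrow> y \<in> carrier L \<Longrightarrow> h (x \<otimes>\<^bsub>L\<^esub> y) = h x \<otimes>\<^bsub>M\<^esub> h y"
  by (auto simp: lie_hom_def)

lemma lie_hom_id: "(\<lambda>x. x) \<in> lie_end L"
  by (auto simp: lie_hom_def)

lemma lie_autD:
  assumes "g \<in> lie_aut L"
  shows "g \<in> lie_end L" "bij_betw g (carrier L) (carrier L)"
  using assms by (auto simp: lie_aut_def)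

lemma lie_aut_comp: "g \<in> lie_aut L \<Longrightarrow> h \<in> lie_aut L \<Longrightarrow> g \<circ> h \<in> lie_aut L"
  by (auto simp: lie_aut_def intro: lie_hom_comp bij_betw_trans)

lemma lie_aut_id: "(\<lambda>x. x) \<in> lie_aut L"
  by (auto simp: lie_aut_def lie_hom_id bij_betw_def)

context lie_algebra
begin

lemma smult_zero_right [simp]: "c \<odot> \<zero> = \<zero>"
  by (metis M.zero_closed mult_zero_right smult_0 smult_smult)

lemma a_inv_smult: "x \<in> carrier L \<Longrightarrow> \<ominus> x = (- 1) \<odot> x"
  using smult_minus_one[of x] by (metis M.minus_equality smult_in)

lemma bracket_zero_left [simp]: "x \<in> carrier L \<Longrightarrow> \<zero> \<otimes> x = \<zero>"
  using bracket_smult_left[of \<zero> x 0] by (simp add: smult_0)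

lemma bracket_zero_right [simp]: "x \<in> carrier L \<Longrightarrow> x \<otimes> \<zero> = \<zero>"
  using bracket_smult_right[of x \<zero> 0] by (simp add: smult_0)

lemma lie_hom_zero:
  assumes "lie_algebra M" "h \<in> lie_hom L M"
  shows "h \<zero> = \<zero>\<^bsub>M\<^esub>"
proof -
  interpret N: lie_algebra M by fact
  have "h \<zero> \<in> carrier M" using lie_hom_closed[OF assms(2)] by simp
  then show ?thesis using lie_hom_smult[OF assms(2), of \<zero> 0] by (simp add: N.smult_0)
qed

lemmas end_closed [simp] = lie_hom_closed[of _ L L]
lemmas end_add = lie_hom_add[of _ L L]
lemmas end_smult = lie_hom_smult[of _ L L]
lemmas end_bracket = lie_hom_bracket[of _ L L]
lemmas end_zero [simp] = lie_hom_zero[OF lie_algebra_axioms]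

lemma end_minus:
  assumes "g \<in> lie_end L" "x \<in> carrier L"
  shows "g (\<ominus> x) = \<ominus> g x"
  using assms by (simp add: a_inv_smult end_smult)

lemma bracket_antisym:
  assumes "x \<in> carrier L" "y \<in> carrier L"
  shows "x \<otimes> y = (- 1) \<odot> (y \<otimes> x)"
  using bracket_anticomm[OF lie_algebra_axioms _ assms, of "carrier L"] carrier_is_submodule
  by (simp add: lie_ideal_def)

lemma lie_aut_inverse:
  assumes g: "g \<in> lie_aut L"
  shows "\<exists>h\<in>lie_aut L. \<forall>x\<in>carrier L. h (g x) = x \<and> g (h x) = x"
proof -
  let ?h = "inv_into (carrier L) g"
  note gE = lie_autD(1)[OF g] and gb = lie_autD(2)[OF g]
  have hg: "?h (g x) = x" if "x \<in> carrier L" for x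
    using gb that by (simp add: bij_betw_def)
  have gh: "g (?h x) = x" if "x \<in> carrier L" for x
    using gb that by (metis bij_betw_inv_into_right)
  have hb: "bij_betw ?h (carrier L) (carrier L)" using gb by (rule bij_betw_inv_into)
  then have hc [simp]: "?h x \<in> carrier L" if "x \<in> carrier L" for x
    using that by (rule bij_betwE[THEN bspec])
  have "?h \<in> lie_aut L"
    unfolding lie_aut_def lie_hom_def
  proof (intro CollectI conjI ballI allI hb)
    fix x y c assume x: "x \<in> carrier L" and y: "y \<in> carrier L"
    show "?h (x \<oplus> y) = ?h x \<oplus> ?h y"
      using hg[of "?h x \<oplus> ?h y"] x y by (simp add: end_add[OF gE] gh)
    show "?h (x \<otimes> y) = ?h x \<otimes> ?h y"
      using hg[of "?h x \<otimes> ?h y"] x y by (simp add: end_bracket[OF gE] gh)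
  next
    fix x c assume x: "x \<in> carrier L"
    show "?h (c \<odot> x) = c \<odot> ?h x"
      using hg[of "c \<odot> ?h x"] x by (simp add: end_smult[OF gE] gh)
  qed simp
  then show ?thesis using hg gh by blast
qed


section \<open>Subspaces and spans\<close>

abbreviation subspace :: "'a set \<Rightarrow> bool"
  where "subspace W \<equiv> submodule W scalars L"

abbreviation lspan :: "'a set \<Rightarrow> 'a set"
  where "lspan S \<equiv> (\<lambda>W. submodule W scalars L) hull S"

lemma subspaceI:
  assumes "W \<subseteq> carrier L" "\<zero> \<in> W" "\<And>x y. x \<in> W \<Longrightarrow> y \<in> W \<Longrightarrow> x \<oplus> y \<in> W"
    "\<And>c x. x \<in> W \<Longrightarrow> c \<odot> x \<in> W"
  shows "subspace W"
  using assms by (intro submoduleI) (auto simp: a_inv_smult subset_eq)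

lemma subspaceD:
  assumes "subspace W"
  shows "W \<subseteq> carrier L" "\<zero> \<in> W" "\<And>x y. x \<in> W \<Longrightarrow> y \<in> W \<Longrightarrow> x \<oplus> y \<in> W"
    "\<And>c x. x \<in> W \<Longrightarrow> c \<odot> x \<in> W" "\<And>x. x \<in> W \<Longrightarrow> \<ominus> x \<in> W"
proof -
  show "W \<subseteq> carrier L" using submoduleE(1)[OF assms] .
  show s: "c \<odot> x \<in> W" if "x \<in> W" for c x using submoduleE(4)[OF assms, of c x] that by simp
  show "x \<oplus> y \<in> W" if "x \<in> W" "y \<in> W" for x y using submoduleE(5)[OF assms] that .
  show "\<ominus> x \<in> W" if "x \<in> W" for x using submoduleE(3)[OF assms] that .
  obtain x where "x \<in> W" using submoduleE(2)[OF assms] by blast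
  then show "\<zero> \<in> W" using s[of x 0] smult_0[of x] submoduleE(1)[OF assms] by auto
qed

lemma subspace_zero: "subspace {\<zero>}"
  by (rule subspaceI) auto

lemma lspan_subspace: "S \<subseteq> carrier L \<Longrightarrow> subspace (lspan S)"
proof (rule subspaceI)
  assume S: "S \<subseteq> carrier L"
  then show "lspan S \<subseteq> carrier L" using carrier_is_submodule by (rule hull_minimal)
qed (auto simp: hull_def subspaceD)

lemma lspan_minimal: "S \<subseteq> W \<Longrightarrow> subspace W \<Longrightarrow> lspan S \<subseteq> W"
  by (rule hull_minimal)

lemma lspan_carrier: "S \<subseteq> carrier L \<Longrightarrow> x \<in> lspan S \<Longrightarrow> x \<in> carrier L"
  using lspan_minimal[OF _ carrier_is_submodule] by blast

lemma lspan_induct [consumes 2, case_names gen zero add smult]: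
  assumes "x \<in> lspan S" "S \<subseteq> carrier L"
    and gen: "\<And>x. x \<in> S \<Longrightarrow> P x" and zero: "P \<zero>"
    and add: "\<And>x y. x \<in> lspan S \<Longrightarrow> y \<in> lspan S \<Longrightarrow> P x \<Longrightarrow> P y \<Longrightarrow> P (x \<oplus> y)"
    and smult: "\<And>c x. x \<in> lspan S \<Longrightarrow> P x \<Longrightarrow> P (c \<odot> x)"
  shows "P x"
proof -
  note T = lspan_subspace[OF assms(2)]
  have "lspan S \<subseteq> {x \<in> lspan S. P x}"
    by (rule lspan_minimal, use gen in \<open>auto intro: hull_inc\<close>, rule subspaceI)
      (use T zero add smult in \<open>auto simp: subspaceD subset_eq dest: lspan_carrier[OF assms(2)]\<close>)
  then show ?thesis using assms(1) by blast
qed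

lemma lspan_image_end:
  assumes g: "g \<in> lie_end L" and S: "S \<subseteq> carrier L"
  shows "g ` lspan S = lspan (g ` S)"
proof
  have gS: "g ` S \<subseteq> carrier L" using S g by auto
  note T = lspan_subspace[OF S] and T' = lspan_subspace[OF gS]
  note c = lspan_carrier[OF S]
  have "g x \<in> lspan (g ` S)" if "x \<in> lspan S" for x
    using that S
    by (induction rule: lspan_induct)
      (auto simp: g end_add end_smult c subspaceD[OF T'] intro: hull_inc)
  then show "g ` lspan S \<subseteq> lspan (g ` S)" by blast
  have "subspace (g ` lspan S)"
  proof (rule subspaceI)
    show "g ` lspan S \<subseteq> carrier L" using g c by auto
    show "\<zero> \<in> g ` lspan S" using subspaceD(2)[OF T] g by (metis end_zero imageI)
    show "x \<oplus> y \<in> g ` lspan S" if "x \<in> g ` lspan S" "y \<in> g ` lspan S" for x y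
      using that g c subspaceD(3)[OF T] by (auto simp flip: end_add)
    show "k \<odot> x \<in> g ` lspan S" if "x \<in> g ` lspan S" for x k
      using that g c subspaceD(4)[OF T] by (auto simp flip: end_smult)
  qed
  then show "lspan (g ` S) \<subseteq> g ` lspan S"
    by (intro lspan_minimal) (auto intro: hull_inc)
qed


section \<open>Congruence modulo a subspace\<close>

text \<open>The carrier conditions are part of the relation, so that a chain of congruences needs no side
  conditions.\<close>

definition cong_mod :: "'a set \<Rightarrow> 'a \<Rightarrow> 'a \<Rightarrow> bool"
  where "cong_mod W x y \<longleftrightarrow> x \<in> carrier L \<and> y \<in> carrier L \<and> (\<exists>w\<in>W. x = y \<oplus> w)"

lemma cong_modD: "cong_mod W x y \<Longrightarrow> x \<in> carrier L" "cong_mod W x y \<Longrightarrow> y \<in> carrier L"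
  by (auto simp: cong_mod_def)

lemma cong_mod_mono: "cong_mod W x y \<Longrightarrow> W \<subseteq> W' \<Longrightarrow> cong_mod W' x y"
  by (auto simp: cong_mod_def)

lemma cong_mod_zero_iff: "subspace W \<Longrightarrow> cong_mod W x \<zero> \<longleftrightarrow> x \<in> W"
  using subspaceD(1) by (auto simp: cong_mod_def subset_eq)

context
  fixes W assumes W: "subspace W"
begin

lemma cong_mod_refl: "x \<in> carrier L \<Longrightarrow> cong_mod W x x"
  using subspaceD(2)[OF W] by (auto simp: cong_mod_def intro!: bexI[of _ \<zero>])

lemma cong_mod_sym: "cong_mod W x y \<Longrightarrow> cong_mod W y x"
  using subspaceD(1)[OF W] subspaceD(5)[OF W] unfolding cong_mod_def
  by (auto simp: M.a_assoc M.r_neg subset_eq intro!: bexI[of _ "\<ominus> _"])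

lemma cong_mod_trans [trans]: "cong_mod W x y \<Longrightarrow> cong_mod W y z \<Longrightarrow> cong_mod W x z"
  using subspaceD(1)[OF W] subspaceD(3)[OF W] unfolding cong_mod_def
  by (auto simp: M.a_assoc subset_eq)

lemma cong_mod_add:
  assumes "cong_mod W x y" "cong_mod W x' y'"
  shows "cong_mod W (x \<oplus> x') (y \<oplus> y')"
proof -
  from assms obtain w w' where w: "w \<in> W" "x = y \<oplus> w" "w' \<in> W" "x' = y' \<oplus> w'"
    and c: "y \<in> carrier L" "y' \<in> carrier L" by (auto simp: cong_mod_def)
  moreover have "w \<in> carrier L" "w' \<in> carrier L" using w subspaceD(1)[OF W] by auto
  ultimately show ?thesis using subspaceD(3)[OF W]
    by (auto simp: cong_mod_def M.a_ac intro!: bexI[of _ "w \<oplus> w'"])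
qed

lemma cong_mod_smult:
  assumes "cong_mod W x y"
  shows "cong_mod W (c \<odot> x) (c \<odot> y)"
  using assms subspaceD(1,4)[OF W]
  by (auto simp: cong_mod_def smult_add_right subset_eq)

lemma cong_mod_end:
  assumes "cong_mod W x y" "g \<in> lie_end L" "g ` W \<subseteq> W'"
  shows "cong_mod W' (g x) (g y)"
  using assms subspaceD(1)[OF W] by (auto simp: cong_mod_def end_add subset_eq)

end


section \<open>The lower central series\<close>

text \<open>The index is shifted: \<open>gam k\<close> is the term \<open>\<gamma>\<^bsub>k+1\<^esub>\<close> of the introduction, \<open>gam 0\<close> is the
  algebra and \<open>gam (Suc 0)\<close> its derived algebra.\<close>

declare lower_central.simps(2) [simp del]

abbreviation gam :: "nat \<Rightarrow> 'a set"
  where "gam \<equiv> lower_central L"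

lemma gam_subset: "gam k \<subseteq> carrier L"
  and gam_subspace: "subspace (gam k)"
proof -
  have "gam k \<subseteq> carrier L \<and> subspace (gam k)"
  proof (induction k)
    case 0
    show ?case by (simp add: carrier_is_submodule)
  next
    case (Suc k)
    then have "{x \<otimes> y | x y. x \<in> gam k \<and> y \<in> carrier L} \<subseteq> carrier L" by auto
    from lspan_subspace[OF this] show ?case
      by (auto simp: lower_central.simps(2) lie_commutator_def dest: subspaceD(1))
  qed
  then show "gam k \<subseteq> carrier L" "subspace (gam k)" by auto
qed

lemma gam_carrier [simp]: "x \<in> gam k \<Longrightarrow> x \<in> carrier L"
  using gam_subset by blast

lemmas gam_zero [simp] = subspaceD(2)[OF gam_subspace]
  and gam_add [simp] = subspaceD(3)[OF gam_subspace]
  and gam_smult [simp] = subspaceD(4)[OF gam_subspace]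
  and gam_minus [simp] = subspaceD(5)[OF gam_subspace]

lemma gam_Suc_minimal:
  assumes "subspace W" "\<And>x y. x \<in> gam k \<Longrightarrow> y \<in> carrier L \<Longrightarrow> x \<otimes> y \<in> W"
  shows "gam (Suc k) \<subseteq> W"
  unfolding lower_central.simps lie_commutator_def
  by (rule lspan_minimal) (use assms in auto)

lemma gam_bracket: "x \<in> gam k \<Longrightarrow> y \<in> carrier L \<Longrightarrow> x \<otimes> y \<in> gam (Suc k)"
  unfolding lower_central.simps lie_commutator_def by (rule hull_inc) auto

lemma gam_bracket_left: "x \<in> carrier L \<Longrightarrow> y \<in> gam k \<Longrightarrow> x \<otimes> y \<in> gam (Suc k)"
  using bracket_antisym[of x y] gam_bracket[of y k x] gam_smult by simp

lemma gam_Suc_subset: "gam (Suc k) \<subseteq> gam k"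
proof (induction k)
  case (Suc k)
  then show ?case by (intro gam_Suc_minimal gam_subspace gam_bracket) auto
qed (use gam_subset[of "Suc 0"] in simp)

lemma gam_antimono: "i \<le> j \<Longrightarrow> gam j \<subseteq> gam i"
  using gam_Suc_subset by (rule lift_Suc_antimono_le)

text \<open>By the Jacobi identity \<open>[x, [p, q]]\<close> is a combination of \<open>[p, [q, x]]\<close> and \<open>[q, [x, p]]\<close>, where
  \<open>x\<close> is bracketed twice.\<close>

lemma gam_bracket_derived:
  assumes x: "x \<in> gam k" and y: "y \<in> gam (Suc 0)"
  shows "x \<otimes> y \<in> gam (Suc (Suc k))"
proof -
  have "gam (Suc 0) \<subseteq> {y \<in> carrier L. x \<otimes> y \<in> gam (Suc (Suc k))}" (is "_ \<subseteq> ?W")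
  proof (rule gam_Suc_minimal)
    show "subspace ?W"
      using x by (intro subspaceI) (auto simp: bracket_add_right bracket_smult_right)
    fix p q assume "p \<in> gam 0" "q \<in> carrier L"
    then have pq: "p \<in> carrier L" "q \<in> carrier L" by auto
    note xc = gam_carrier[OF x]
    have 1: "p \<otimes> (q \<otimes> x) \<in> gam (Suc (Suc k))" "q \<otimes> (x \<otimes> p) \<in> gam (Suc (Suc k))"
      using x pq by (auto intro: gam_bracket_left[OF _ gam_bracket_left]
          gam_bracket_left[OF _ gam_bracket])
    have "x \<otimes> (p \<otimes> q) = \<ominus> (p \<otimes> (q \<otimes> x) \<oplus> q \<otimes> (x \<otimes> p))"
      using jacobi[OF xc pq] xc pq
      by (simp add: M.a_assoc M.minus_equality[symmetric])
    also have "\<dots> \<in> gam (Suc (Suc k))" using 1 by simp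
    finally show "p \<otimes> q \<in> ?W" using pq by simp
  qed
  then show ?thesis using y by auto
qed

lemma lie_hom_lower_central:
  assumes "lie_algebra M" and h: "h \<in> lie_hom L M" and x: "x \<in> gam k"
  shows "h x \<in> lower_central M k"
proof -
  interpret N: lie_algebra M by fact
  have "h ` gam k \<subseteq> N.gam k"
  proof (induction k)
    case 0
    then show ?case using lie_hom_closed[OF h] by auto
  next
    case (Suc k)
    have "gam (Suc k) \<subseteq> {x \<in> carrier L. h x \<in> N.gam (Suc k)}" (is "_ \<subseteq> ?W")
    proof (rule gam_Suc_minimal)
      show "subspace ?W"
        by (intro subspaceI) (auto simp: lie_hom_add[OF h] lie_hom_smult[OF h]
            lie_hom_zero[OF assms(1) h])
      fix x y assume "x \<in> gam k" "y \<in> carrier L"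
      then show "x \<otimes> y \<in> ?W"
        using Suc lie_hom_closed[OF h]
        by (auto simp: lie_hom_bracket[OF h] intro!: N.gam_bracket)
    qed
    then show ?case by blast
  qed
  then show ?thesis using x by blast
qed

lemmas end_gam [simp] = lie_hom_lower_central[OF lie_algebra_axioms]

lemma end_cong_gam:
  "cong_mod (gam k) x y \<Longrightarrow> g \<in> lie_end L \<Longrightarrow> cong_mod (gam k) (g x) (g y)"
  by (rule cong_mod_end[OF gam_subspace]) (auto)

text \<open>The loss of precision in the second factor is made up by the depth of the first: changing \<open>y\<close> by
  an element of the derived algebra moves the bracket by two steps in the series.\<close>

lemma cong_bracket:
  assumes "cong_mod (gam (Suc k)) x x'" "x' \<in> gam k" "cong_mod (gam (Suc 0)) y y'"
  shows "cong_mod (gam (Suc (Suc k))) (x \<otimes> y) (x' \<otimes> y')"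
proof -
  from assms obtain w v where w: "w \<in> gam (Suc k)" "x = x' \<oplus> w" and v: "v \<in> gam (Suc 0)" "y = y' \<oplus> v"
    and c: "x' \<in> carrier L" "y' \<in> carrier L"
    by (auto simp: cong_mod_def)
  note cc = c gam_carrier[OF w(1)] gam_carrier[OF v(1)]
  have "x \<otimes> y = x' \<otimes> y' \<oplus> (x' \<otimes> v \<oplus> w \<otimes> y)"
    unfolding w v using cc by (simp add: bracket_add_left bracket_add_right M.a_ac)
  moreover have "x' \<otimes> v \<oplus> w \<otimes> y \<in> gam (Suc (Suc k))"
    using assms(2) w(1) v cc
    by (intro gam_add gam_bracket_derived gam_bracket) auto
  ultimately show ?thesis using cc v w by (auto simp: cong_mod_def)
qed

text \<open>An endomorphism that is the identity on the abelianisation is the identity on every factor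
  of the lower central series, because the factors are generated by brackets of elements.\<close>

lemma end_trivial_on_factors:
  assumes g: "g \<in> lie_end L" and triv: "\<And>x. x \<in> carrier L \<Longrightarrow> cong_mod (gam (Suc 0)) (g x) x"
    and x: "x \<in> gam k"
  shows "cong_mod (gam (Suc k)) (g x) x"
  using x
proof (induction k arbitrary: x)
  case 0
  then show ?case using triv by simp
next
  case (Suc k)
  have "gam (Suc k) \<subseteq> {x \<in> carrier L. cong_mod (gam (Suc (Suc k))) (g x) x}" (is "_ \<subseteq> ?W")
  proof (rule gam_Suc_minimal)
    show "subspace ?W"
      by (rule subspaceI)
        (auto simp: g end_add end_smult intro: cong_mod_refl cong_mod_add cong_mod_smult gam_subspace
         )
    fix x y assume x: "x \<in> gam k" and y: "y \<in> carrier L"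
    then show "x \<otimes> y \<in> ?W"
      using Suc.IH[OF x] triv[OF y] by (simp add: g end_bracket cong_bracket)
  qed
  then show ?case using Suc.prems by blast
qed

end

section \<open>Iterated brackets with a pattern of admissible entries\<close>

context lie_algebra
begin

text \<open>The left-normed brackets \<open>[[[x\<^sub>1, x\<^sub>2], x\<^sub>3], \<dots>, x\<^sub>n]\<close> in which each entry ranges over its own set.
  The head of the list belongs to the outermost entry \<open>x\<^sub>n\<close>, so that consing is bracketing on the
  right. Patterns with distinct sets keep track of which entries come from which generators.\<close>

primrec words :: "'a set list \<Rightarrow> 'a set"
  where
    "words [] = {}"
  | "words (S # Ss) = (if Ss = [] then S else {w \<otimes> a | w a. w \<in> words Ss \<and> a \<in> S})"

lemma words_carrier: "\<forall>S\<in>set Ss. S \<subseteq> carrier L \<Longrightarrow> words Ss \<subseteq> carrier L"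
  by (induction Ss) auto

lemma words_mono: "list_all2 (\<subseteq>) Ss Ts \<Longrightarrow> words Ss \<subseteq> words Ts"
proof (induction rule: list_all2_induct)
  case (Cons S Ss T Ts)
  then have "Ss = [] \<longleftrightarrow> Ts = []" by auto
  then show ?case using Cons by auto
qed simp

lemma words_step: "w \<in> words Ss \<Longrightarrow> a \<in> S \<Longrightarrow> w \<otimes> a \<in> words (S # Ss)"
  by (cases "Ss = []") (simp_all, blast)

lemma words_gam:
  "\<forall>S\<in>set Ss. S \<subseteq> carrier L \<Longrightarrow> length Ss = Suc k \<Longrightarrow> words Ss \<subseteq> gam k"
proof (induction Ss arbitrary: k)
  case (Cons S Ss)
  show ?case
  proof (cases k)
    case 0
    then show ?thesis using Cons.prems by simp
  next
    case (Suc m)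
    then have "words Ss \<subseteq> gam m" using Cons by simp
    then show ?thesis using Suc Cons.prems by (auto intro!: gam_bracket)
  qed
qed simp

lemma words_image_end:
  assumes g: "g \<in> lie_end L"
  shows "\<forall>S\<in>set Ss. S \<subseteq> carrier L \<Longrightarrow> g ` words Ss = words (map ((`) g) Ss)"
proof (induction Ss)
  case (Cons S Ss)
  then have IH: "words (map ((`) g) Ss) = g ` words Ss" by simp
  have "g (w \<otimes> a) = g w \<otimes> g a" if "w \<in> words Ss" "a \<in> S" for w a
    using that Cons.prems words_carrier[of Ss] by (intro end_bracket[OF g]) auto
  then have "g ` {w \<otimes> a | w a. w \<in> words Ss \<and> a \<in> S} = {w \<otimes> a | w a. w \<in> g ` words Ss \<and> a \<in> g ` S}"
    by (force simp: image_iff)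
  then show ?case by (simp add: IH)
qed simp

lemma lspan_words_image_end:
  assumes "g \<in> lie_end L" "\<forall>S\<in>set Ss. S \<subseteq> carrier L"
  shows "g ` lspan (words Ss) = lspan (words (map ((`) g) Ss))"
  using assms by (simp add: lspan_image_end words_carrier words_image_end)

lemma words_end_eq:
  assumes "p \<in> lie_end L" "q \<in> lie_end L" "\<forall>S\<in>set Ss. S \<subseteq> carrier L"
    and "\<forall>S\<in>set Ss. \<forall>a\<in>S. p a = q a" and "w \<in> words Ss"
  shows "p w = q w"
  using assms(3-)
proof (induction Ss arbitrary: w)
  case (Cons S Ss)
  show ?case
  proof (cases "Ss = []")
    case False
    then obtain v a where "w = v \<otimes> a" "v \<in> words Ss" "a \<in> S" using Cons.prems by auto
    then show ?thesis using Cons words_carrier[of Ss]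
      by (auto simp: end_bracket[OF assms(1)] end_bracket[OF assms(2)] subset_eq)
  qed (use Cons in auto)
qed simp

lemma lspan_words_end_eq:
  assumes p: "p \<in> lie_end L" and q: "q \<in> lie_end L" and S: "\<forall>S\<in>set Ss. S \<subseteq> carrier L"
    and eq: "\<forall>S\<in>set Ss. \<forall>a\<in>S. p a = q a" and w: "w \<in> lspan (words Ss)"
  shows "p w = q w"
  using w words_carrier[OF S]
proof (induction rule: lspan_induct)
  case (gen x)
  then show ?case using words_end_eq[OF p q S eq] by blast
qed (simp_all add: p q end_add end_smult lspan_carrier[OF words_carrier[OF S]])

text \<open>Linearity in a single entry: if endomorphisms \<open>p, q, r\<close> agree on all entries but one, and
  \<open>p = q + r\<close> on that one, then \<open>p = q + r\<close> on the whole bracket.\<close>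

lemma words_slot_add:
  assumes E: "p \<in> lie_end L" "q \<in> lie_end L" "r \<in> lie_end L"
    and "\<forall>T\<in>set (Ps @ S # Rs). T \<subseteq> carrier L"
    and "\<forall>T\<in>set (Ps @ Rs). \<forall>a\<in>T. p a = q a \<and> q a = r a"
    and "\<forall>a\<in>S. p a = q a \<oplus> r a" and "w \<in> words (Ps @ S # Rs)"
  shows "p w = q w \<oplus> r w"
  using assms(4-)
proof (induction Ps arbitrary: w)
  case Nil
  show ?case
  proof (cases "Rs = []")
    case False
    then obtain v a where w: "w = v \<otimes> a" "v \<in> words Rs" "a \<in> S" using Nil by auto
    then have c: "v \<in> carrier L" "a \<in> carrier L" using words_carrier[of Rs] Nil by auto
    have "p v = r v" "q v = r v"
      using words_end_eq[of p r Rs v] words_end_eq[of q r Rs v] E Nil w by auto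
    then show ?thesis using w c Nil E by (simp add: end_bracket bracket_add_right)
  qed (use Nil in auto)
next
  case (Cons P Ps)
  then obtain v a where w: "w = v \<otimes> a" "v \<in> words (Ps @ S # Rs)" "a \<in> P" by auto
  then have c: "v \<in> carrier L" "a \<in> carrier L" using words_carrier[of "Ps @ S # Rs"] Cons by auto
  have "p v = q v \<oplus> r v" using Cons w by auto
  moreover have "p a = r a" "q a = r a" using Cons w by auto
  ultimately show ?case using w c E by (simp add: end_bracket bracket_add_left)
qed

lemma lspan_words_slot_add:
  assumes E: "p \<in> lie_end L" "q \<in> lie_end L" "r \<in> lie_end L"
    and S: "\<forall>T\<in>set (Ps @ S # Rs). T \<subseteq> carrier L"
    and *: "\<forall>T\<in>set (Ps @ Rs). \<forall>a\<in>T. p a = q a \<and> q a = r a"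
      "\<forall>a\<in>S. p a = q a \<oplus> r a"
    and w: "w \<in> lspan (words (Ps @ S # Rs))"
  shows "p w = q w \<oplus> r w"
  using w words_carrier[OF S]
proof (induction rule: lspan_induct)
  case (gen x)
  then show ?case using words_slot_add[OF E S *] by blast
next
  case (add x y)
  then have "x \<in> carrier L" "y \<in> carrier L" using lspan_carrier[OF words_carrier[OF S]] by auto
  then show ?case using E add by (simp add: end_add M.a_ac)
next
  case (smult c x)
  then have "x \<in> carrier L" using lspan_carrier[OF words_carrier[OF S]] by auto
  then show ?case using E smult by (simp add: end_smult smult_add_right)
qed (use E in simp)

text \<open>The bound on the number of generators in a bracket feeds the pigeonhole argument in
  \<open>realizable_all\<close>.\<close>

lemma words_finite_support:
  "w \<in> words (replicate n A) \<Longrightarrow>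
    \<exists>D\<subseteq>A. finite D \<and> card D \<le> n \<and> w \<in> words (replicate n D)"
proof (induction n arbitrary: w)
  case (Suc n)
  show ?case
  proof (cases "n = 0")
    case True
    then show ?thesis using Suc.prems by (intro exI[of _ "{w}"]) auto
  next
    case False
    then obtain v a where w: "w = v \<otimes> a" "v \<in> words (replicate n A)" "a \<in> A"
      using Suc.prems by auto
    obtain D where D: "D \<subseteq> A" "finite D" "card D \<le> n" "v \<in> words (replicate n D)"
      using Suc.IH[OF w(2)] by blast
    have "words (replicate n D) \<subseteq> words (replicate n (insert a D))"
      by (rule words_mono) (auto simp: list_all2_conv_all_nth)
    then show ?thesis using w D False
      by (intro exI[of _ "insert a D"]) (auto simp: card_insert_if)
  qed
qed simp

lemma lspan_mono: "S \<subseteq> T \<Longrightarrow> x \<in> lspan S \<Longrightarrow> x \<in> lspan T"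
  using hull_mono by blast

end


section \<open>Free Lie algebras\<close>

locale free_lie_algebra = lie_algebra L
  for L :: "('k::field, 'a) module" (structure) +
  fixes B :: "'a set"
  assumes basis: "free_lie_basis L B"
begin

lemma basis_subset: "B \<subseteq> carrier L"
  using basis by (simp add: free_lie_basis_def)

lemma basis_carrier [simp]: "b \<in> B \<Longrightarrow> b \<in> carrier L"
  using basis_subset by blast

lemma hom_ext:
  fixes M :: "('k, 'b) module"
  assumes M: "lie_algebra M" and "g \<in> lie_hom L M" "h \<in> lie_hom L M"
    and "\<And>b. b \<in> B \<Longrightarrow> g b = h b" and "x \<in> carrier L"
  shows "g x = h x"
proof -
  have "g \<in> B \<rightarrow> carrier M" using lie_hom_closed[OF assms(2)] by auto
  from free_lie_basis_universal[OF lie_algebra_axioms M basis this]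
  show ?thesis using assms by metis
qed

definition free_end :: "('a \<Rightarrow> 'a) \<Rightarrow> 'a \<Rightarrow> 'a"
  where "free_end f = (SOME h. h \<in> lie_end L \<and> (\<forall>b\<in>B. h b = f b))"

lemma
  assumes "\<And>b. b \<in> B \<Longrightarrow> f b \<in> carrier L"
  shows free_end: "free_end f \<in> lie_end L"
    and free_end_basis: "b \<in> B \<Longrightarrow> free_end f b = f b"
proof -
  have "f \<in> B \<rightarrow> carrier L" using assms by auto
  from free_lie_basis_universal[OF lie_algebra_axioms lie_algebra_axioms basis this]
  have "\<exists>h. h \<in> lie_end L \<and> (\<forall>b\<in>B. h b = f b)" by blast
  from someI_ex[OF this]
  show "free_end f \<in> lie_end L" "b \<in> B \<Longrightarrow> free_end f b = f b"
    unfolding free_end_def by auto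
qed

text \<open>Freeness implies generation: the identity of \<open>B\<close> extends to a homomorphism from \<open>L\<close> to the
  subalgebra \<open>W\<close>, and by uniqueness of extensions this map is the identity of \<open>L\<close>.\<close>

lemma subalgebra_containing_basis:
  assumes W: "subspace W" and br: "\<And>x y. x \<in> W \<Longrightarrow> y \<in> W \<Longrightarrow> x \<otimes> y \<in> W" and B: "B \<subseteq> W"
  shows "carrier L \<subseteq> W"
proof
  fix x assume x: "x \<in> carrier L"
  let ?M = "L\<lparr>carrier := W\<rparr>"
  note Wc = subspaceD(1)[OF W]
  have J: "x \<otimes> (y \<otimes> z) \<oplus> (y \<otimes> (z \<otimes> x) \<oplus> z \<otimes> (x \<otimes> y)) = \<zero>"
    if "x \<in> carrier L" "y \<in> carrier L" "z \<in> carrier L" for x y z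
    using jacobi[OF that] that by (simp add: M.a_assoc)
  have M: "lie_algebra ?M"
    by (rule lie_algebraI)
      (use Wc subspaceD(2-4)[OF W] br in \<open>auto simp: M.a_assoc smult_minus_one smult_add_left
        smult_add_right smult_smult smult_1 bracket_add_left bracket_add_right bracket_smult_left
        bracket_smult_right bracket_self J subset_eq intro: M.a_comm\<close>)
  have "(\<lambda>b. b) \<in> B \<rightarrow> carrier ?M" using B by auto
  from free_lie_basis_universal[OF lie_algebra_axioms M basis this]
  obtain h where h: "h \<in> lie_hom L ?M" "\<forall>b\<in>B. h b = b"
    by (elim bexE conjE) (rule that)
  have "(\<lambda>x. x) \<in> lie_hom ?M L"
    unfolding lie_hom_def using Wc by (intro CollectI conjI ballI allI funcsetI) auto
  from lie_hom_comp[OF h(1) this] have "h \<in> lie_end L" by (simp add: comp_def)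
  from hom_ext[OF lie_algebra_axioms this lie_hom_id _ x] have "h x = x" using h(2) by simp
  then show "x \<in> W" using lie_hom_closed[OF h(1) x] by simp
qed

lemma linear_part:
  assumes "x \<in> carrier L"
  obtains s where "s \<in> lspan B" "cong_mod (gam (Suc 0)) x s"
proof -
  note S = lspan_subspace[OF basis_subset] and G = gam_subspace[of "Suc 0"]
  let ?W = "{x. \<exists>s\<in>lspan B. cong_mod (gam (Suc 0)) x s}"
  have "carrier L \<subseteq> ?W"
  proof (rule subalgebra_containing_basis)
    show "subspace ?W"
    proof (rule subspaceI)
      show "?W \<subseteq> carrier L" by (auto dest: cong_modD)
      show "\<zero> \<in> ?W" using subspaceD(2)[OF S] cong_mod_refl[OF G] by auto
      show "x \<oplus> y \<in> ?W" if "x \<in> ?W" "y \<in> ?W" for x y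
        using that subspaceD(3)[OF S] cong_mod_add[OF G] by blast
      show "k \<odot> x \<in> ?W" if "x \<in> ?W" for k x
        using that subspaceD(4)[OF S] cong_mod_smult[OF G] by blast
    qed
    show "B \<subseteq> ?W" using cong_mod_refl[OF G] by (auto intro!: bexI hull_inc)
    show "x \<otimes> y \<in> ?W" if "x \<in> ?W" "y \<in> ?W" for x y
    proof -
      have "x \<in> carrier L" "y \<in> carrier L" using that by (auto dest: cong_modD)
      then have "cong_mod (gam (Suc 0)) (x \<otimes> y) \<zero>"
        using gam_bracket[of x 0 y] by (simp add: cong_mod_zero_iff[OF G])
      then show ?thesis using subspaceD(2)[OF S] by blast
    qed
  qed
  then show ?thesis using assms that by blast
qed

lemma lie_autI:
  assumes g: "g \<in> lie_end L" and h: "h \<in> lie_end L"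
    and "\<And>b. b \<in> B \<Longrightarrow> g (h b) = b" "\<And>b. b \<in> B \<Longrightarrow> h (g b) = b"
  shows "g \<in> lie_aut L"
proof -
  have gh: "g (h x) = x" if "x \<in> carrier L" for x
    using hom_ext[OF lie_algebra_axioms lie_hom_comp[OF h g] lie_hom_id _ that] assms(3) by auto
  have hg: "h (g x) = x" if "x \<in> carrier L" for x
    using hom_ext[OF lie_algebra_axioms lie_hom_comp[OF g h] lie_hom_id _ that] assms(4) by auto
  have "bij_betw g (carrier L) (carrier L)"
    by (rule bij_betw_byWitness[where f' = h]) (use g h gh hg in auto)
  then show ?thesis using g by (simp add: lie_aut_def)
qed

lemma end_cong_derived:
  assumes g: "g \<in> lie_end L" and h: "h \<in> lie_end L"
    and eq: "\<And>b. b \<in> B \<Longrightarrow> cong_mod (gam (Suc 0)) (g b) (h b)" and x: "x \<in> carrier L"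
  shows "cong_mod (gam (Suc 0)) (g x) (h x)"
proof -
  note G = gam_subspace[of "Suc 0"]
  have "carrier L \<subseteq> {x \<in> carrier L. cong_mod (gam (Suc 0)) (g x) (h x)}" (is "_ \<subseteq> ?W")
  proof (rule subalgebra_containing_basis)
    show "subspace ?W"
    proof (rule subspaceI)
      show "\<zero> \<in> ?W" using cong_mod_refl[OF G] by (simp add: g h)
      show "x \<oplus> y \<in> ?W" if "x \<in> ?W" "y \<in> ?W" for x y
        using that cong_mod_add[OF G] by (simp add: end_add[OF g] end_add[OF h])
      show "k \<odot> x \<in> ?W" if "x \<in> ?W" for x k
        using that cong_mod_smult[OF G] by (simp add: end_smult[OF g] end_smult[OF h])
    qed blast
    show "B \<subseteq> ?W" using eq by auto
    show "x \<otimes> y \<in> ?W" if "x \<in> ?W" "y \<in> ?W" for x y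
    proof -
      have c: "x \<in> carrier L" "y \<in> carrier L" using that by auto
      have "cong_mod (gam (Suc 0)) z \<zero>" if "z \<in> gam (Suc 0)" for z
        using that by (simp add: cong_mod_zero_iff[OF G])
      moreover have "e (x \<otimes> y) \<in> gam (Suc 0)" if "e \<in> lie_end L" for e
        using gam_bracket[of "e x" 0 "e y"] c that by (simp add: end_bracket)
      ultimately have "cong_mod (gam (Suc 0)) (g (x \<otimes> y)) (h (x \<otimes> y))"
        using g h cong_mod_trans[OF G] cong_mod_sym[OF G] by blast
      then show ?thesis using c by simp
    qed
  qed
  then show ?thesis using x by blast
qed

text \<open>Induction on \<open>k\<close>: in \<open>[x, y]\<close> replace \<open>x\<close> by its part of lowest degree and \<open>y\<close> by its linear
  part; by \<open>cong_bracket\<close> the error is two steps further down.\<close>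

lemma gam_generated_by_words:
  assumes "x \<in> gam k"
  shows "\<exists>s\<in>lspan (words (replicate (Suc k) B)). cong_mod (gam (Suc k)) x s"
  using assms
proof (induction k arbitrary: x)
  case 0
  then show ?case using linear_part[of x] by auto
next
  case (Suc k)
  let ?X = "words (replicate (Suc k) B)" and ?Y = "words (replicate (Suc (Suc k)) B)"
  have X: "?X \<subseteq> carrier L" and Y: "?Y \<subseteq> carrier L"
    using words_carrier basis_subset by (auto simp del: words.simps replicate.simps)
  note SY = lspan_subspace[OF Y] and G = gam_subspace[of "Suc (Suc k)"]
  have mult: "s \<otimes> c \<in> lspan ?Y" if s: "s \<in> lspan ?X" and c: "c \<in> lspan B" for s c
  proof -
    have cc: "c \<in> carrier L" using c lspan_carrier[OF basis_subset] by blast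
    note sc = lspan_carrier[OF X]
    show ?thesis using s X
    proof (induction rule: lspan_induct)
      case (gen w)
      then have w: "w \<in> carrier L" using X by blast
      from c basis_subset show ?case
      proof (induction rule: lspan_induct)
        case (gen b)
        then show ?case using words_step[OF \<open>w \<in> ?X\<close>, of b B] by (intro hull_inc) simp
      qed (use w subspaceD[OF SY] lspan_carrier[OF basis_subset] in
          \<open>auto simp: bracket_add_right bracket_smult_right\<close>)
    qed (use cc sc subspaceD[OF SY] in \<open>auto simp: bracket_add_left bracket_smult_left\<close>)
  qed
  have "gam (Suc k) \<subseteq> {x. \<exists>s\<in>lspan ?Y. cong_mod (gam (Suc (Suc k))) x s}" (is "_ \<subseteq> ?W")
  proof (rule gam_Suc_minimal)
    show "subspace ?W"
    proof (rule subspaceI)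
      show "?W \<subseteq> carrier L" by (auto dest: cong_modD)
      show "\<zero> \<in> ?W" using subspaceD(2)[OF SY] cong_mod_refl[OF G M.zero_closed] by blast
      show "x \<oplus> y \<in> ?W" if "x \<in> ?W" "y \<in> ?W" for x y
        using that subspaceD(3)[OF SY] cong_mod_add[OF G] by blast
      show "c \<odot> x \<in> ?W" if "x \<in> ?W" for c x
        using that subspaceD(4)[OF SY] cong_mod_smult[OF G] by blast
    qed
    fix x y assume "x \<in> gam k" and y: "y \<in> carrier L"
    then obtain s c where s: "s \<in> lspan ?X" "cong_mod (gam (Suc k)) x s"
      and c: "c \<in> lspan B" "cong_mod (gam (Suc 0)) y c"
      using Suc.IH linear_part by metis
    have "lspan ?X \<subseteq> gam k"
      using words_gam[of "replicate (Suc k) B" k] basis_subset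
      by (intro lspan_minimal gam_subspace) (simp_all del: words.simps replicate.simps)
    then have "cong_mod (gam (Suc (Suc k))) (x \<otimes> y) (s \<otimes> c)"
      using s c by (intro cong_bracket) auto
    then show "x \<otimes> y \<in> ?W" using mult[OF s(1) c(1)] by blast
  qed
  then show ?case using Suc.prems by blast
qed

end

section \<open>Realizable families\<close>

context free_lie_algebra
begin

definition realizable :: "nat \<Rightarrow> ('a \<Rightarrow> 'a) \<Rightarrow> bool"
  where "realizable k u \<longleftrightarrow>
    (\<exists>\<theta>\<in>lie_aut L. \<forall>b\<in>B. cong_mod (gam (Suc k)) (\<theta> b) (b \<oplus> u b))"

lemma realizable_cong:
  assumes "realizable k u" "\<And>b. b \<in> B \<Longrightarrow> cong_mod (gam (Suc k)) (v b) (u b)"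
  shows "realizable k v"
proof -
  note G = gam_subspace[of "Suc k"]
  from assms(1) obtain \<theta> where \<theta>: "\<theta> \<in> lie_aut L"
    "\<forall>b\<in>B. cong_mod (gam (Suc k)) (\<theta> b) (b \<oplus> u b)" unfolding realizable_def by blast
  have "cong_mod (gam (Suc k)) (\<theta> b) (b \<oplus> v b)" if "b \<in> B" for b
    using \<theta>(2) that cong_mod_trans[OF G] cong_mod_add[OF G cong_mod_refl[OF G]]
      cong_mod_sym[OF G assms(2)[OF that]] basis_carrier by blast
  then show ?thesis using \<theta>(1) unfolding realizable_def by blast
qed

lemma realizable_eq:
  assumes "realizable k u" "\<And>b. b \<in> B \<Longrightarrow> u b \<in> carrier L" "\<And>b. b \<in> B \<Longrightarrow> v b = u b"
  shows "realizable k v"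
  using assms by (intro realizable_cong[OF assms(1)]) (simp add: cong_mod_refl[OF gam_subspace])

lemma realizer_trivial_on_factor:
  assumes \<theta>: "\<theta> \<in> lie_end L" "\<And>b. b \<in> B \<Longrightarrow> cong_mod (gam (Suc k)) (\<theta> b) (b \<oplus> u b)"
    and u: "\<And>b. b \<in> B \<Longrightarrow> u b \<in> gam k" and k: "0 < k" and x: "x \<in> gam k"
  shows "cong_mod (gam (Suc k)) (\<theta> x) x"
proof (rule end_trivial_on_factors[OF \<theta>(1) _ x])
  fix x assume "x \<in> carrier L"
  note G = gam_subspace[of "Suc 0"]
  show "cong_mod (gam (Suc 0)) (\<theta> x) x"
  proof (rule end_cong_derived[OF \<theta>(1) lie_hom_id _ \<open>x \<in> carrier L\<close>])
    fix b assume b: "b \<in> B"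
    have "u b \<in> gam (Suc 0)" using gam_antimono[of "Suc 0" k] k u[OF b] by auto
    then have "cong_mod (gam (Suc 0)) (b \<oplus> u b) b"
      using b by (auto simp: cong_mod_def)
    moreover have "cong_mod (gam (Suc 0)) (\<theta> b) (b \<oplus> u b)"
      using cong_mod_mono[OF \<theta>(2)[OF b] gam_antimono] by simp
    ultimately show "cong_mod (gam (Suc 0)) (\<theta> b) b" using cong_mod_trans[OF G] by blast
  qed
qed

lemma realizable_zero: "realizable k (\<lambda>b. \<zero>)"
  unfolding realizable_def
  by (rule bexI[OF _ lie_aut_id]) (simp add: cong_mod_refl[OF gam_subspace])

lemma realizable_add:
  assumes k: "0 < k" and u: "\<And>b. b \<in> B \<Longrightarrow> u b \<in> gam k" and v: "\<And>b. b \<in> B \<Longrightarrow> v b \<in> gam k"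
    and "realizable k u" "realizable k v"
  shows "realizable k (\<lambda>b. u b \<oplus> v b)"
proof -
  note G = gam_subspace[of "Suc k"]
  from assms obtain \<theta> \<eta> where \<theta>: "\<theta> \<in> lie_aut L"
      "\<And>b. b \<in> B \<Longrightarrow> cong_mod (gam (Suc k)) (\<theta> b) (b \<oplus> u b)"
    and \<eta>: "\<eta> \<in> lie_aut L" "\<And>b. b \<in> B \<Longrightarrow> cong_mod (gam (Suc k)) (\<eta> b) (b \<oplus> v b)"
    unfolding realizable_def by blast
  note \<theta>E = lie_autD(1)[OF \<theta>(1)]
  have "cong_mod (gam (Suc k)) ((\<theta> \<circ> \<eta>) b) (b \<oplus> (u b \<oplus> v b))" if b: "b \<in> B" for b
  proof -
    have c: "u b \<in> carrier L" "v b \<in> carrier L" using u[OF b] v[OF b] by simp_all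
    have "cong_mod (gam (Suc k)) (\<theta> (\<eta> b)) (\<theta> (b \<oplus> v b))"
      using end_cong_gam \<eta>(2)[OF b] \<theta>E by blast
    also have "\<theta> (b \<oplus> v b) = \<theta> b \<oplus> \<theta> (v b)" using b c \<theta>E by (simp add: end_add)
    also have "cong_mod (gam (Suc k)) (\<theta> b \<oplus> \<theta> (v b)) ((b \<oplus> u b) \<oplus> v b)"
      using realizer_trivial_on_factor[OF \<theta>E \<theta>(2) u k v] \<theta>(2) b
      by (intro cong_mod_add[OF G]) auto
    finally (cong_mod_trans[OF G]) show ?thesis using b c by (simp add: M.a_assoc)
  qed
  then show ?thesis using lie_aut_comp[OF \<theta>(1) \<eta>(1)]
    unfolding realizable_def by blast
qed

text \<open>The last assumption says that \<open>u b\<close> lies in the subalgebra generated by \<open>B - U\<close>. Then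
  \<open>b \<mapsto> b + u b\<close> has the inverse \<open>b \<mapsto> b - u b\<close>, as both maps fix the values of \<open>u\<close>.\<close>

lemma realizable_elementary:
  assumes U: "U \<subseteq> B" and u: "\<And>b. b \<in> B \<Longrightarrow> u b \<in> carrier L"
    and supp: "\<And>b. b \<in> B \<Longrightarrow> b \<notin> U \<Longrightarrow> u b = \<zero>"
    and indep: "\<And>g b. g \<in> lie_end L \<Longrightarrow> \<forall>c\<in>B - U. g c = c \<Longrightarrow> b \<in> U \<Longrightarrow> g (u b) = u b"
  shows "realizable k u"
proof -
  define \<theta> where "\<theta> = free_end (\<lambda>b. b \<oplus> u b)"
  define \<eta> where "\<eta> = free_end (\<lambda>b. b \<oplus> \<ominus> u b)"
  have \<theta>: "\<theta> \<in> lie_end L" "\<And>b. b \<in> B \<Longrightarrow> \<theta> b = b \<oplus> u b"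
    unfolding \<theta>_def using u by (auto intro!: free_end free_end_basis)
  have \<eta>: "\<eta> \<in> lie_end L" "\<And>b. b \<in> B \<Longrightarrow> \<eta> b = b \<oplus> \<ominus> u b"
    unfolding \<eta>_def using u by (auto intro!: free_end free_end_basis)
  have ufix: "\<theta> (u b) = u b" "\<eta> (u b) = u b" if "b \<in> B" for b
    using indep[of \<theta> b] indep[of \<eta> b] that \<theta> \<eta> supp by (cases "b \<in> U"; auto)+
  have "\<theta> \<in> lie_aut L"
    by (rule lie_autI[OF \<theta>(1) \<eta>(1)])
      (auto simp: \<theta> \<eta> end_add end_minus u ufix M.a_assoc M.r_neg M.l_neg)
  then show ?thesis unfolding realizable_def
    using \<theta> u by (auto intro!: bexI[of _ \<theta>] cong_mod_refl[OF gam_subspace])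
qed

text \<open>Let \<open>\<theta>\<close> realize \<open>D\<close>, and extend \<open>D\<close> additively to sums of generators. The assumption \<open>comm\<close> is
  \<open>g D = D g + u\<close> on \<open>B\<close>, for an automorphism \<open>g\<close> that sends a generator \<open>b\<close> to \<open>b\<close> or to a sum
  \<open>b + b'\<close> of generators. So \<open>g \<theta> b \<equiv> \<theta> (g b) + u b\<close>. Now apply \<open>\<theta>\<inverse>\<close>, which is trivial on
  \<open>u b\<close>, and then \<open>g\<inverse>\<close>, which fixes \<open>u b\<close>: the commutator \<open>g\<inverse> \<theta>\<inverse> g \<theta>\<close> realizes \<open>u\<close>.\<close>

lemma realizable_commutator:
  assumes k: "0 < k" and D: "\<And>b. b \<in> B \<Longrightarrow> D b \<in> gam k" and u: "\<And>b. b \<in> B \<Longrightarrow> u b \<in> gam k"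
    and real: "realizable k D" and g: "g \<in> lie_aut L"
    and gu: "\<And>b. b \<in> B \<Longrightarrow> g (u b) = u b"
    and comm: "\<And>b. b \<in> B \<Longrightarrow> g b = b \<and> g (D b) = D b \<oplus> u b \<or>
      (\<exists>b'\<in>B. g b = b \<oplus> b' \<and> g (D b) = (D b \<oplus> D b') \<oplus> u b)"
  shows "realizable k u"
proof -
  note G = gam_subspace[of "Suc k"]
  note refl = cong_mod_refl[OF G] and sym = cong_mod_sym[OF G] and trans = cong_mod_trans[OF G]
  from real obtain \<theta> where \<theta>: "\<theta> \<in> lie_aut L"
    "\<And>b. b \<in> B \<Longrightarrow> cong_mod (gam (Suc k)) (\<theta> b) (b \<oplus> D b)" unfolding realizable_def by blast
  obtain h where h: "h \<in> lie_aut L" "\<And>x. x \<in> carrier L \<Longrightarrow> h (g x) = x"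
    using lie_aut_inverse[OF g] by metis
  obtain \<eta> where \<eta>: "\<eta> \<in> lie_aut L" "\<And>x. x \<in> carrier L \<Longrightarrow> \<eta> (\<theta> x) = x"
    using lie_aut_inverse[OF \<theta>(1)] by metis
  note E = lie_autD(1)[OF g] lie_autD(1)[OF h(1)] lie_autD(1)[OF \<theta>(1)] lie_autD(1)[OF \<eta>(1)]
  have \<eta>_trivial: "cong_mod (gam (Suc k)) (\<eta> x) x" if "x \<in> gam k" for x
  proof -
    have x: "x \<in> carrier L" using that by simp
    have "cong_mod (gam (Suc k)) (\<theta> x) x"
      using realizer_trivial_on_factor[OF E(3) \<theta>(2) D k that] .
    from end_cong_gam[OF this E(4)] show ?thesis using \<eta>(2)[OF x] sym by simp
  qed
  have "cong_mod (gam (Suc k)) ((h \<circ> (\<eta> \<circ> (g \<circ> \<theta>))) b) (b \<oplus> u b)" if b: "b \<in> B" for b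
  proof -
    have c: "b \<in> carrier L" "D b \<in> carrier L" "u b \<in> carrier L" using b D[OF b] u[OF b] by simp_all
    have "cong_mod (gam (Suc k)) (g (\<theta> b)) (g (b \<oplus> D b))"
      using end_cong_gam \<theta>(2)[OF b] E(1) by blast
    also have "g (b \<oplus> D b) = g b \<oplus> g (D b)" using c E by (simp add: end_add)
    also have "cong_mod (gam (Suc k)) (g b \<oplus> g (D b)) (\<theta> (g b) \<oplus> u b)"
      using comm[OF b]
    proof (elim disjE conjE bexE)
      assume "g b = b" "g (D b) = D b \<oplus> u b"
      then show ?thesis
        using cong_mod_add[OF G sym[OF \<theta>(2)[OF b]] refl[OF c(3)]] c by (simp add: M.a_assoc)
    next
      fix b' assume b': "b' \<in> B" and gb: "g b = b \<oplus> b'" "g (D b) = (D b \<oplus> D b') \<oplus> u b"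
      have c': "b' \<in> carrier L" "D b' \<in> carrier L" using b' D[OF b'] by simp_all
      have "cong_mod (gam (Suc k)) (((b \<oplus> D b) \<oplus> (b' \<oplus> D b')) \<oplus> u b)
          ((\<theta> b \<oplus> \<theta> b') \<oplus> u b)"
        by (intro cong_mod_add[OF G] sym[OF \<theta>(2)] refl b b' c)
      moreover have "\<theta> b \<oplus> \<theta> b' = \<theta> (g b)" using c c' E gb by (simp add: end_add)
      moreover have "((b \<oplus> D b) \<oplus> (b' \<oplus> D b')) \<oplus> u b = g b \<oplus> g (D b)"
        unfolding gb using c c' by (simp add: M.a_ac)
      ultimately show ?thesis by simp
    qed
    finally (trans) have "cong_mod (gam (Suc k)) (\<eta> (g (\<theta> b))) (\<eta> (\<theta> (g b) \<oplus> u b))"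
      using end_cong_gam E(4) by blast
    also have "\<eta> (\<theta> (g b) \<oplus> u b) = g b \<oplus> \<eta> (u b)"
      using c E by (simp add: end_add \<eta>(2))
    also have "cong_mod (gam (Suc k)) (g b \<oplus> \<eta> (u b)) (g b \<oplus> u b)"
      using \<eta>_trivial[OF u[OF b]] c E by (intro cong_mod_add[OF G] refl) auto
    finally (trans) have "cong_mod (gam (Suc k)) (h (\<eta> (g (\<theta> b)))) (h (g b \<oplus> u b))"
      using end_cong_gam E(2) by blast
    moreover have "h (g b \<oplus> u b) = b \<oplus> u b"
      using c E h(2)[OF c(1)] h(2)[OF c(3)] gu[OF b] by (simp add: end_add)
    ultimately show ?thesis by simp
  qed
  moreover have "h \<circ> (\<eta> \<circ> (g \<circ> \<theta>)) \<in> lie_aut L"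
    by (intro lie_aut_comp g h(1) \<theta>(1) \<eta>(1))
  ultimately show ?thesis unfolding realizable_def by blast
qed


section \<open>The swindle\<close>

text \<open>Level \<open>0\<close> of the copies is \<open>B\<close> itself; the higher levels are disjoint copies inside \<open>F\<close>, and
  they leave infinitely many elements of \<open>F\<close> unused, so that the construction can be repeated.\<close>

lemma infinitely_many_copies:
  assumes cB: "countable B" and F: "infinite F" "F \<subseteq> B"
  shows "\<exists>c F'. (\<forall>a. c 0 a = a) \<and> (\<forall>i. \<forall>a\<in>B. c (Suc i) a \<in> F - F') \<and>
    (\<forall>i j. \<forall>a\<in>B. \<forall>a'\<in>B. c (Suc i) a = c (Suc j) a' \<longleftrightarrow> i = j \<and> a = a') \<and>
    infinite F' \<and> F' \<subseteq> F"
proof -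
  obtain f :: "nat \<Rightarrow> 'a" where f: "inj f" "range f \<subseteq> F"
    using infinite_countable_subset[OF F(1)] by blast
  let ?n = "to_nat_on B"
  \<comment> \<open>Even positions of an enumeration hold the copies; odd positions are kept in reserve.\<close>
  have n: "inj_on ?n B" using cB by (rule inj_on_to_nat_on)
  define c where "c i a = (case i of 0 \<Rightarrow> a | Suc j \<Rightarrow> f (2 * prod_encode (j, ?n a)))" for i a
  define F' where "F' = range (\<lambda>n. f (2 * n + 1))"
  show ?thesis
  proof (intro exI[of _ c] exI[of _ F'] conjI allI ballI)
    show "c 0 a = a" for a by (simp add: c_def)
    show "c (Suc i) a \<in> F - F'" for i a
    proof -
      have "2 * m \<noteq> 2 * n + 1" for m n :: nat by presburger
      then show ?thesis using f by (auto simp: c_def F'_def inj_eq)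
    qed
    show "c (Suc i) a = c (Suc j) a' \<longleftrightarrow> i = j \<and> a = a'" if "a \<in> B" "a' \<in> B" for i j a a'
      using f(1) that n by (auto simp: c_def inj_eq inj_on_eq_iff)
    have "inj (\<lambda>n. f (2 * n + 1))" by (rule injI) (use f(1) in \<open>auto dest!: injD\<close>)
    then show "infinite F'" unfolding F'_def by (rule range_inj_infinite)
    show "F' \<subseteq> F" using f(2) by (auto simp: F'_def)
  qed
qed

text \<open>The family \<open>u\<close> is supported on \<open>Y\<close>, its values are combinations of brackets with pattern
  \<open>Ps @ Rs\<close>, and \<open>F\<close> is a reserve of generators that do not occur. Entries in \<open>Rs\<close> are known to
  avoid \<open>Y\<close>; the induction transfers the last set \<open>S\<close> of \<open>Ps\<close> to \<open>Rs\<close>. If \<open>Ps\<close> is empty, the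
  family is elementary.

  In the step, let \<open>u y[a]\<close> stand for the value \<open>u y\<close> with its \<open>S\<close>-entry \<open>a\<close> displayed, and let
  \<open>c i\<close> be the \<open>i\<close>-th copy of the generators outside \<open>F\<close>. The family
  \<open>D (c i y) = u y[c (i+1) a]\<close> is realizable: the part \<open>i = 0\<close> by the induction hypothesis, since its
  displayed entry now avoids \<open>Y\<close>, and the parts of even and of odd levels \<open>i > 0\<close> because each is
  elementary. The shift \<open>g\<close> with \<open>c (i+1) a \<mapsto> c (i+1) a + c i a\<close> fixes the remaining entries, so
  \<open>g D - D g\<close> telescopes to \<open>u y[a]\<close> at level \<open>0\<close> and \<open>realizable_commutator\<close> applies.\<close>

lemma realizable_words:
  assumes k: "0 < k" and cB: "countable B" and Y: "Y \<subseteq> B"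
  shows "\<lbrakk>infinite F; F \<subseteq> B; Y \<inter> F = {}; \<forall>S\<in>set (Ps @ Rs). S \<subseteq> B - F; \<forall>R\<in>set Rs. R \<inter> Y = {};
    length (Ps @ Rs) = Suc k; \<forall>y\<in>Y. u y \<in> lspan (words (Ps @ Rs)); \<forall>b\<in>B - Y. u b = \<zero>\<rbrakk> \<Longrightarrow>
    realizable k u"
proof (induction Ps arbitrary: Rs F u rule: rev_induct)
  case Nil
  have Rs: "\<forall>R\<in>set Rs. R \<subseteq> carrier L" using Nil.prems(4) basis_subset by auto
  show ?case
  proof (rule realizable_elementary[OF Y])
    show "u b \<in> carrier L" if "b \<in> B" for b
      using that Nil.prems(7,8) lspan_carrier[OF words_carrier[OF Rs]] by (cases "b \<in> Y") auto
    show "u b = \<zero>" if "b \<in> B" "b \<notin> Y" for b using that Nil.prems(8) by blast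
    fix g b assume g: "g \<in> lie_end L" and gfix: "\<forall>c\<in>B - Y. g c = c" and b: "b \<in> Y"
    have "\<forall>S\<in>set Rs. \<forall>a\<in>S. g a = a" using gfix Nil.prems(4,5) by (simp add: disjoint_iff subset_eq)
    then show "g (u b) = u b"
      using b Nil.prems(7) by (intro lspan_words_end_eq[OF g lie_hom_id Rs]) auto
  qed
next
  case (snoc S Ps)
  note F = snoc.prems(1,2) and YF = snoc.prems(3)
  define A where "A = B - F"
  have A: "A \<subseteq> B" "A \<inter> F = {}" by (auto simp: A_def)
  have sets: "S \<subseteq> A" "\<forall>T\<in>set (Ps @ Rs). T \<subseteq> A" "Y \<subseteq> A" using snoc.prems(3,4) Y by (auto simp: A_def)
  from infinitely_many_copies[OF cB F] obtain c F' where copies: "\<forall>a. c 0 a = a"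
    "\<forall>i. \<forall>a\<in>B. c (Suc i) a \<in> F - F'"
    "\<forall>i j. \<forall>a\<in>B. \<forall>a'\<in>B. c (Suc i) a = c (Suc j) a' \<longleftrightarrow> i = j \<and> a = a'"
    and F': "infinite F'" "F' \<subseteq> F" by (elim exE conjE) (rule that)
  have c0: "c 0 a = a" for a using copies(1) by simp
  have cF: "c (Suc i) a \<in> F - F'" if "a \<in> B" for i a using copies(2) that by simp
  have cinj: "c (Suc i) a = c (Suc j) a' \<longleftrightarrow> i = j \<and> a = a'" if "a \<in> B" "a' \<in> B" for i j a a'
    using copies(3) that by simp
  have cB: "c i a \<in> B" if "a \<in> B" for i a
    using that c0 cF F by (cases i) auto
  define C where "C = {c (Suc i) a | i a. a \<in> A}"
  have CF: "C \<subseteq> F" using cF A by (auto simp: C_def)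
  (* Functions on B given by G i a at the copy c (Suc i) a and by d elsewhere. *)
  define ext where "ext G d b = (if b \<in> C then
      (case (SOME (i, a). a \<in> A \<and> b = c (Suc i) a) of (i, a) \<Rightarrow> G i a) else d b)"
    for G :: "nat \<Rightarrow> 'a \<Rightarrow> 'a" and d b
  have ext_copy: "ext G d (c (Suc i) a) = G i a" if "a \<in> A" for G d i a
  proof -
    have "(SOME (j, a'). a' \<in> A \<and> c (Suc i) a = c (Suc j) a') = (i, a)"
      by (rule some_equality) (use that A(1) in \<open>auto simp: cinj subset_eq\<close>)
    then show ?thesis using that by (auto simp: ext_def C_def)
  qed
  have ext_other: "ext G d b = d b" if "b \<notin> C" for G d b using that by (simp add: ext_def)
  have ext_carrier: "ext G d b \<in> carrier L"
    if "b \<in> B" "\<And>i a. a \<in> A \<Longrightarrow> G i a \<in> carrier L" "\<And>b. b \<in> B \<Longrightarrow> d b \<in> carrier L" for G d b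
    using that ext_copy ext_other by (cases "b \<in> C") (auto simp: C_def)
  have Bcases: thesis if "b \<in> B" "b \<notin> C \<Longrightarrow> thesis"
    "\<And>i a. a \<in> A \<Longrightarrow> b = c (Suc i) a \<Longrightarrow> thesis" for b thesis
    using that by (auto simp: C_def)

  define g where "g = free_end (ext (\<lambda>i a. c (Suc i) a \<oplus> c i a) (\<lambda>b. b))"
  have g: "g \<in> lie_end L" "\<And>b. b \<in> B \<Longrightarrow> b \<notin> C \<Longrightarrow> g b = b"
    "\<And>i a. a \<in> A \<Longrightarrow> g (c (Suc i) a) = c (Suc i) a \<oplus> c i a"
  proof -
    have "ext (\<lambda>i a. c (Suc i) a \<oplus> c i a) (\<lambda>b. b) b \<in> carrier L" if "b \<in> B" for b
      by (rule ext_carrier[OF that]) (use A cB in auto)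
    note fe = free_end[OF this] free_end_basis[OF this]
    show "g \<in> lie_end L" "\<And>b. b \<in> B \<Longrightarrow> b \<notin> C \<Longrightarrow> g b = b"
      "\<And>i a. a \<in> A \<Longrightarrow> g (c (Suc i) a) = c (Suc i) a \<oplus> c i a"
      unfolding g_def using fe ext_copy ext_other cB A by auto
  qed
  (* The inverse of g sends c i a to the alternating sum of c i a, ..., c 1 a, a. *)
  define hv where "hv = rec_nat (\<lambda>a. a) (\<lambda>i r a. c (Suc i) a \<oplus> \<ominus> r a)"
  have hv: "hv 0 a = a" "hv (Suc i) a = c (Suc i) a \<oplus> \<ominus> hv i a" for i a
    by (simp_all add: hv_def)
  have hv_carrier: "hv i a \<in> carrier L" if "a \<in> A" for i a
    using that A cB by (induction i) (auto simp: hv)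
  define h where "h = free_end (ext (\<lambda>i a. hv (Suc i) a) (\<lambda>b. b))"
  have h: "h \<in> lie_end L" "\<And>b. b \<in> B \<Longrightarrow> b \<notin> C \<Longrightarrow> h b = b"
    "\<And>i a. a \<in> A \<Longrightarrow> h (c (Suc i) a) = hv (Suc i) a"
  proof -
    have "ext (\<lambda>i a. hv (Suc i) a) (\<lambda>b. b) b \<in> carrier L" if "b \<in> B" for b
      by (rule ext_carrier[OF that]) (use hv_carrier in auto)
    note fe = free_end[OF this] free_end_basis[OF this]
    show "h \<in> lie_end L" "\<And>b. b \<in> B \<Longrightarrow> b \<notin> C \<Longrightarrow> h b = b"
      "\<And>i a. a \<in> A \<Longrightarrow> h (c (Suc i) a) = hv (Suc i) a"
      unfolding h_def using fe ext_copy ext_other cB A by auto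
  qed
  have gA: "g a = a" and hA: "h a = a" if "a \<in> A" for a
    using g(2) h(2) that CF A by blast+
  have ghv: "g (hv i a) = c i a" if a: "a \<in> A" for i a
  proof (induction i)
    case 0
    then show ?case using a by (simp add: hv c0 gA)
  next
    case (Suc i)
    have "c i a \<in> carrier L" "c (Suc i) a \<in> carrier L" using cB A a by auto
    then show ?case using Suc g a hv_carrier[OF a]
      by (simp add: hv end_add end_minus M.a_assoc M.r_neg)
  qed
  have hc: "h (c i a) = hv i a" if "a \<in> A" for i a
    using that h(3) by (cases i) (auto simp: c0 hA hv(1))
  have gaut: "g \<in> lie_aut L"
  proof (rule lie_autI[OF g(1) h(1)])
    show "g (h b) = b" if "b \<in> B" for b
      using that by (rule Bcases) (use g h ghv that in auto)
    show "h (g b) = b" if "b \<in> B" for b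
      using that
    proof (rule Bcases)
      assume "b \<notin> C"
      then show ?thesis using g(2) h(2) that by simp
    next
      fix i a assume a: "a \<in> A" "b = c (Suc i) a"
      have "c i a \<in> carrier L" "c (Suc i) a \<in> carrier L" using cB A a by auto
      then show ?thesis using a g(3) h(1) hc[OF a(1)] hv_carrier[OF a(1)]
        by (simp add: end_add hv(2) M.a_assoc M.l_neg)
    qed
  qed

  (* The substitution \<sigma> m puts the m-th copy in place of the first one. All values are written
     as \<sigma> m (v y), where v y has its displayed entry in the first copy and \<sigma> 0 (v y) = u y. *)
  define \<sigma> where "\<sigma> m = free_end (ext (\<lambda>i a. if i = 0 then c m a else c (Suc i) a) (\<lambda>b. b))" for m
  have \<sigma>: "\<sigma> m \<in> lie_end L" "\<And>b. b \<in> B \<Longrightarrow> b \<notin> C \<Longrightarrow> \<sigma> m b = b"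
    "\<And>a. a \<in> A \<Longrightarrow> \<sigma> m (c (Suc 0) a) = c m a" for m
  proof -
    have "ext (\<lambda>i a. if i = 0 then c m a else c (Suc i) a) (\<lambda>b. b) b \<in> carrier L" if "b \<in> B" for b
      by (rule ext_carrier[OF that]) (use A cB in auto)
    note fe = free_end[OF this] free_end_basis[OF this]
    show "\<sigma> m \<in> lie_end L" "\<And>b. b \<in> B \<Longrightarrow> b \<notin> C \<Longrightarrow> \<sigma> m b = b"
      "\<And>a. a \<in> A \<Longrightarrow> \<sigma> m (c (Suc 0) a) = c m a"
      unfolding \<sigma>_def using fe ext_copy ext_other cB A by auto
  qed
  have \<sigma>A: "\<sigma> m a = a" if "a \<in> A" for m a
    using \<sigma>(2) that CF A by blast

  define Q where "Q m = Ps @ (c m ` S) # Rs" for m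
  have Q_B: "\<forall>T\<in>set (Q m). T \<subseteq> B" for m
  proof -
    have "c m ` S \<subseteq> B" using sets(1) A(1) cB by blast
    moreover have "\<forall>T\<in>set (Ps @ Rs). T \<subseteq> B" using sets(2) A(1) by blast
    ultimately show ?thesis by (simp add: Q_def ball_Un)
  qed
  have Q_carrier: "\<forall>T\<in>set (Q m). T \<subseteq> carrier L" for m
    using Q_B[of m] basis_subset by blast
  have Q0: "Q 0 = (Ps @ [S]) @ Rs" by (simp add: Q_def c0)
  have Q_gam: "lspan (words (Q m)) \<subseteq> gam k" for m
    using words_gam[OF Q_carrier, of m k] snoc.prems(6)
    by (intro lspan_minimal gam_subspace) (auto simp: Q_def)
  have Q_image: "\<sigma> m ` lspan (words (Q (Suc 0))) = lspan (words (Q m))" for m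
  proof -
    have "map ((`) (\<sigma> m)) (Q (Suc 0)) = Q m"
    proof -
      have "\<sigma> m ` T = T" if "T \<subseteq> A" for T
        using that \<sigma>A by (force simp: image_iff subset_eq)
      moreover have "\<sigma> m ` c (Suc 0) ` S = c m ` S"
        using sets(1) \<sigma>(3) by (force simp: image_iff subset_eq)
      ultimately show ?thesis using sets(2) by (simp add: Q_def map_idI)
    qed
    then show ?thesis using lspan_words_image_end[OF \<sigma>(1) Q_carrier, of m "Suc 0"] by simp
  qed
  have "\<forall>y. \<exists>w. y \<in> Y \<longrightarrow> w \<in> lspan (words (Q (Suc 0))) \<and> \<sigma> 0 w = u y"
    using snoc.prems(7) Q_image[of 0] unfolding Q0 by (metis imageE)
  then obtain v where v: "\<And>y. y \<in> Y \<Longrightarrow> v y \<in> lspan (words (Q (Suc 0)))"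
    "\<And>y. y \<in> Y \<Longrightarrow> \<sigma> 0 (v y) = u y" by metis
  have \<sigma>v: "\<sigma> m (v y) \<in> lspan (words (Q m))" if "y \<in> Y" for m y
    using Q_image v(1)[OF that] by blast
  have \<sigma>v_gam: "\<sigma> m (v y) \<in> gam k" if "y \<in> Y" for m y
    using \<sigma>v[OF that] Q_gam by blast
  have shift: "g (\<sigma> (Suc m) (v y)) = \<sigma> (Suc m) (v y) \<oplus> \<sigma> m (v y)" if "y \<in> Y" for m y
  proof -
    have "(g \<circ> \<sigma> (Suc m)) (v y) = \<sigma> (Suc m) (v y) \<oplus> \<sigma> m (v y)"
    proof (rule lspan_words_slot_add[OF lie_hom_comp[OF \<sigma>(1) g(1)] \<sigma>(1) \<sigma>(1)])
      show "v y \<in> lspan (words (Ps @ (c (Suc 0) ` S) # Rs))" using v(1)[OF that] by (simp add: Q_def)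
      show "\<forall>T\<in>set (Ps @ (c (Suc 0) ` S) # Rs). T \<subseteq> carrier L"
        using Q_carrier[of "Suc 0"] by (simp add: Q_def)
      show "\<forall>T\<in>set (Ps @ Rs). \<forall>a\<in>T. (g \<circ> \<sigma> (Suc m)) a = \<sigma> (Suc m) a \<and> \<sigma> (Suc m) a = \<sigma> m a"
        using sets(2) \<sigma>A gA by (auto simp: subset_eq)
      show "\<forall>a\<in>c (Suc 0) ` S. (g \<circ> \<sigma> (Suc m)) a = \<sigma> (Suc m) a \<oplus> \<sigma> m a"
        using sets(1) \<sigma>(3) g(3) by (auto simp: subset_eq)
    qed
    then show ?thesis by simp
  qed

  (* D0 is the part of D at level 0. E P is the part at the levels Suc i with P i; it is elementary
     if no two consecutive levels belong to it, since the values at level m involve level m + 1. *)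
  define D0 where "D0 = ext (\<lambda>i a. \<zero>) (\<lambda>b. if b \<in> Y then \<sigma> (Suc 0) (v b) else \<zero>)"
  define E where "E P = ext (\<lambda>i a. if a \<in> Y \<and> P i then \<sigma> (Suc (Suc i)) (v a) else \<zero>) (\<lambda>b. \<zero>)"
    for P :: "nat \<Rightarrow> bool"
  have D0_real: "realizable k D0"
  proof (rule snoc.IH[of F' "(c (Suc 0) ` S) # Rs" D0, OF F'(1)])
    have YC: "y \<notin> C" if "y \<in> Y" for y using that YF CF by blast
    show "F' \<subseteq> B" "Y \<inter> F' = {}" using F' F YF by auto
    show "\<forall>T\<in>set (Ps @ (c (Suc 0) ` S) # Rs). T \<subseteq> B - F'"
      using sets A F' cF cB by (fastforce simp: subset_eq)
    show "\<forall>R\<in>set (c (Suc 0) ` S # Rs). R \<inter> Y = {}"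
      using snoc.prems(5) sets A cF YF by (fastforce simp: subset_eq)
    show "length (Ps @ c (Suc 0) ` S # Rs) = Suc k" using snoc.prems(6) by simp
    show "\<forall>y\<in>Y. D0 y \<in> lspan (words (Ps @ c (Suc 0) ` S # Rs))"
      using \<sigma>v[of _ "Suc 0"] YC by (simp add: D0_def ext_other Q_def)
    show "\<forall>b\<in>B - Y. D0 b = \<zero>"
    proof
      fix b assume b: "b \<in> B - Y"
      then have "b \<in> B" by simp
      then show "D0 b = \<zero>" by (rule Bcases) (use b in \<open>auto simp: D0_def ext_other ext_copy\<close>)
    qed
  qed
  have E_copy: "E P (c (Suc i) a) = (if a \<in> Y \<and> P i then \<sigma> (Suc (Suc i)) (v a) else \<zero>)"
    if "a \<in> A" for P i a using that by (simp add: E_def ext_copy)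
  have E_other: "E P b = \<zero>" if "b \<notin> C" for P b using that by (simp add: E_def ext_other)
  have E_gam: "E P b \<in> gam k" if "b \<in> B" for P b
    using that by (rule Bcases) (use \<sigma>v_gam in \<open>auto simp: E_copy E_other\<close>)
  have D0_gam: "D0 b \<in> gam k" if "b \<in> B" for b
    using that by (rule Bcases) (use \<sigma>v_gam in \<open>auto simp: D0_def ext_copy ext_other\<close>)
  have E_real: "realizable k (E P)" if P: "\<And>i. P i \<Longrightarrow> \<not> P (Suc i)" for P
  proof (rule realizable_elementary)
    let ?U = "{c (Suc i) a | i a. a \<in> A \<and> P i}"
    show "?U \<subseteq> B" using cB A by auto
    show "E P b \<in> carrier L" if "b \<in> B" for b using E_gam[OF that] by (rule gam_carrier)
    show "E P b = \<zero>" if "b \<in> B" "b \<notin> ?U" for b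
      using that(1) by (rule Bcases) (use that in \<open>auto simp: E_copy E_other\<close>)
    fix f b assume f: "f \<in> lie_end L" "\<forall>c\<in>B - ?U. f c = c" and "b \<in> ?U"
    then obtain i a where b: "b = c (Suc i) a" "a \<in> A" "P i" by blast
    show "f (E P b) = E P b"
    proof (cases "a \<in> Y")
      case True
      have "T \<inter> ?U = {}" if T: "T \<in> set (Q (Suc (Suc i)))" for T
      proof -
        consider "T \<subseteq> A" | "T = c (Suc (Suc i)) ` S" using T sets(2) by (auto simp: Q_def)
        then show ?thesis
        proof cases
          case 1
          then show ?thesis using CF A unfolding C_def by blast
        next
          case 2
          have neq: "c (Suc (Suc i)) s \<noteq> c (Suc j) a'" if "s \<in> S" "a' \<in> A" "P j" for s j a'
          proof -
            have "s \<in> B" "a' \<in> B" using that sets(1) A(1) by auto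
            then show ?thesis using cinj[of s a' "Suc i" j] P[OF b(3)] that(3) by auto
          qed
          show ?thesis
          proof (rule equals0I)
            fix x assume "x \<in> T \<inter> ?U"
            then obtain s j a' where "s \<in> S" "x = c (Suc (Suc i)) s" "a' \<in> A" "P j" "x = c (Suc j) a'"
              using 2 by auto
            then show False using neq[of s a' j] by simp
          qed
        qed
      qed
      then have "\<forall>T\<in>set (Q (Suc (Suc i))). \<forall>x\<in>T. f x = x"
        using f(2) Q_B[of "Suc (Suc i)"] by blast
      then have "f (\<sigma> (Suc (Suc i)) (v a)) = \<sigma> (Suc (Suc i)) (v a)"
        using lspan_words_end_eq[OF f(1) lie_hom_id Q_carrier _ \<sigma>v[OF True]] by simp
      then show ?thesis using b True by (simp add: E_copy)
    qed (use b f(1) in \<open>simp add: E_copy\<close>)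
  qed
  define D where "D b = (D0 b \<oplus> E even b) \<oplus> E odd b" for b
  have D_copy: "D (c (Suc i) a) = (if a \<in> Y then \<sigma> (Suc (Suc i)) (v a) else \<zero>)" if "a \<in> A" for i a
    using that gam_carrier[OF \<sigma>v_gam] by (auto simp: D_def D0_def ext_copy E_copy)
  have D_other: "D b = (if b \<in> Y then \<sigma> (Suc 0) (v b) else \<zero>)" if "b \<notin> C" for b
    using that gam_carrier[OF \<sigma>v_gam] by (auto simp: D_def D0_def ext_other E_other)
  have D_level: "D (c i a) = (if a \<in> Y then \<sigma> (Suc i) (v a) else \<zero>)" if "a \<in> A" for i a
  proof (cases i)
    case 0
    have "a \<notin> C" using that CF A by blast
    then show ?thesis using 0 D_other by (simp add: c0)
  qed (use that D_copy in simp)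
  have D_real: "realizable k D"
    unfolding D_def
    by (intro realizable_add[OF k] D0_real E_real gam_add D0_gam E_gam) auto
  show ?case
  proof (rule realizable_commutator[OF k _ _ D_real gaut])
    show "D b \<in> gam k" if "b \<in> B" for b
      unfolding D_def using that by (intro gam_add D0_gam E_gam)
    show u_gam: "u b \<in> gam k" if "b \<in> B" for b
      using that snoc.prems(7,8) Q_gam[of 0] unfolding Q0 by (cases "b \<in> Y") auto
    show "g (u b) = u b" if "b \<in> B" for b
    proof (cases "b \<in> Y")
      case True
      have "\<forall>T\<in>set (Q 0). \<forall>a\<in>T. g a = a"
        using sets(1,2) gA by (simp add: Q0 ball_Un subset_eq)
      then show ?thesis
        using lspan_words_end_eq[OF g(1) lie_hom_id Q_carrier, of 0 "u b"] snoc.prems(7) True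
        by (simp add: Q0)
    qed (use snoc.prems(8) that g(1) in simp)
    fix b assume b: "b \<in> B"
    then show "g b = b \<and> g (D b) = D b \<oplus> u b \<or>
      (\<exists>b'\<in>B. g b = b \<oplus> b' \<and> g (D b) = (D b \<oplus> D b') \<oplus> u b)"
    proof (rule Bcases)
      assume bC: "b \<notin> C"
      have "g (D b) = D b \<oplus> u b"
        using D_other[OF bC] shift[of b 0] v(2)[of b] snoc.prems(8) b g(1) by simp
      then show ?thesis using g(2)[OF b bC] by simp
    next
      fix i a assume a: "a \<in> A" "b = c (Suc i) a"
      have "b \<in> F" using a cF A by auto
      then have "u b = \<zero>" using YF snoc.prems(8) b by blast
      moreover have "\<sigma> m (v a) \<in> carrier L" if "a \<in> Y" for m
        using \<sigma>v_gam[OF that] by (rule gam_carrier)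
      ultimately have "g (D b) = (D b \<oplus> D (c i a)) \<oplus> u b"
        using a(1) shift[of a "Suc i"] g(1) unfolding a(2) D_copy[OF a(1)] D_level[OF a(1)] by simp
      moreover have "c i a \<in> B" "g b = b \<oplus> c i a" using a g(3) cB A by auto
      ultimately show ?thesis by blast
    qed
  qed
qed

end

section \<open>All families are realizable\<close>

context lie_algebra
begin

text \<open>The sum \<open>W 0 + \<dots> + W (n - 1)\<close>, built one summand at a time so that a choice of summands for each
  generator can be made by induction.\<close>

primrec subspace_sum :: "(nat \<Rightarrow> 'a set) \<Rightarrow> nat \<Rightarrow> 'a set"
  where
    "subspace_sum W 0 = {\<zero>}"
  | "subspace_sum W (Suc n) = {x \<oplus> y | x y. x \<in> subspace_sum W n \<and> y \<in> W n}"

lemma subspace_sum_subspace: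
  assumes W: "\<And>i. i < n \<Longrightarrow> subspace (W i)"
  shows "subspace (subspace_sum W n)"
  using W
proof (induction n)
  case 0
  then show ?case by (simp add: subspace_zero)
next
  case (Suc n)
  then have S: "subspace (subspace_sum W n)" and Wn: "subspace (W n)" by auto
  note c = subsetD[OF subspaceD(1)[OF S]] subsetD[OF subspaceD(1)[OF Wn]]
  show ?case
  proof (rule subspaceI)
    show "subspace_sum W (Suc n) \<subseteq> carrier L" using c by auto
    show "\<zero> \<in> subspace_sum W (Suc n)"
      using subspaceD(2)[OF S] subspaceD(2)[OF Wn] by (auto intro!: exI[of _ \<zero>])
    fix x y k assume x: "x \<in> subspace_sum W (Suc n)"
    then obtain a b where ab: "x = a \<oplus> b" "a \<in> subspace_sum W n" "b \<in> W n" by auto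
    have "k \<odot> x = k \<odot> a \<oplus> k \<odot> b" using ab c by (simp add: smult_add_right)
    then show "k \<odot> x \<in> subspace_sum W (Suc n)"
      using subspaceD(4)[OF S ab(2)] subspaceD(4)[OF Wn ab(3)] by auto
    assume "y \<in> subspace_sum W (Suc n)"
    then obtain a' b' where ab': "y = a' \<oplus> b'" "a' \<in> subspace_sum W n" "b' \<in> W n" by auto
    have "x \<oplus> y = (a \<oplus> a') \<oplus> (b \<oplus> b')" using ab ab' c by (simp add: M.a_ac)
    then show "x \<oplus> y \<in> subspace_sum W (Suc n)"
      using subspaceD(3)[OF S ab(2) ab'(2)] subspaceD(3)[OF Wn ab(3) ab'(3)] by auto
  qed
qed

lemma subspace_sum_summand:
  assumes W: "\<And>i. i < n \<Longrightarrow> subspace (W i)" and i: "i < n"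
  shows "W i \<subseteq> subspace_sum W n"
  using W i
proof (induction n)
  case (Suc n)
  have S: "subspace (subspace_sum W n)" by (rule subspace_sum_subspace) (use Suc.prems in simp)
  have Wn: "subspace (W n)" using Suc.prems by simp
  show ?case
  proof
    fix x assume x: "x \<in> W i"
    show "x \<in> subspace_sum W (Suc n)"
    proof (cases "i = n")
      case True
      then have "x = \<zero> \<oplus> x" using x subspaceD(1)[OF Wn] by auto
      then show ?thesis using True x subspaceD(2)[OF S] by auto
    next
      case False
      then have xn: "x \<in> subspace_sum W n" using Suc x by auto
      then have "x = x \<oplus> \<zero>" using subspaceD(1)[OF S] by auto
      then show ?thesis using xn subspaceD(2)[OF Wn] by auto
    qed
  qed
qed simp

end

context free_lie_algebra
begin

lemma realizable_subspace_sum: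
  assumes k: "0 < k" and W: "\<And>i b. i < n \<Longrightarrow> b \<in> B \<Longrightarrow> W b i \<subseteq> gam k"
    and real: "\<And>i w. i < n \<Longrightarrow> (\<And>b. b \<in> B \<Longrightarrow> w b \<in> W b i) \<Longrightarrow> realizable k w"
    and u: "\<And>b. b \<in> B \<Longrightarrow> u b \<in> subspace_sum (W b) n"
  shows "(\<forall>b\<in>B. u b \<in> gam k) \<and> realizable k u"
  using W real u
proof (induction n arbitrary: u)
  case 0
  then show ?case using realizable_eq[OF realizable_zero, where v = u] by simp
next
  case (Suc n)
  have "\<forall>b\<in>B. \<exists>x y. u b = x \<oplus> y \<and> x \<in> subspace_sum (W b) n \<and> y \<in> W b n"
    using Suc.prems(3) by simp
  then obtain v w where vw: "\<And>b. b \<in> B \<Longrightarrow> u b = v b \<oplus> w b"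
    "\<And>b. b \<in> B \<Longrightarrow> v b \<in> subspace_sum (W b) n" "\<And>b. b \<in> B \<Longrightarrow> w b \<in> W b n" by metis
  have v: "(\<forall>b\<in>B. v b \<in> gam k) \<and> realizable k v"
  proof (rule Suc.IH)
    show "W b i \<subseteq> gam k" if "i < n" "b \<in> B" for i b using Suc.prems(1) that by simp
    show "realizable k w" if "i < n" "\<And>b. b \<in> B \<Longrightarrow> w b \<in> W b i" for i w
      using Suc.prems(2)[of i w] that by simp
    show "v b \<in> subspace_sum (W b) n" if "b \<in> B" for b using vw(2) that .
  qed
  have w: "w b \<in> gam k" if "b \<in> B" for b using Suc.prems(1)[of n b] vw(3) that by auto
  have "realizable k w" using Suc.prems(2)[of n w] vw(3) by simp
  then have real: "realizable k (\<lambda>b. v b \<oplus> w b)" using v w k by (intro realizable_add) auto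
  have mem: "v b \<oplus> w b \<in> gam k" if "b \<in> B" for b using v w that by simp
  have "realizable k u" by (rule realizable_eq[OF real gam_carrier[OF mem] vw(1)])
  then show ?case using mem vw(1) by simp
qed

text \<open>Up to the next term of the series, \<open>u b\<close> is a combination of brackets of \<open>k + 1\<close> generators. Such
  a bracket and \<open>b\<close> involve at most \<open>k + 2\<close> generators, so with \<open>k + 3\<close> colours some colour class is
  missed and can serve as the reserve in \<open>realizable_words\<close>.\<close>

theorem realizable_all:
  assumes cB: "countable B" and iB: "infinite B" and k: "0 < k"
    and u: "\<And>b. b \<in> B \<Longrightarrow> u b \<in> gam k"
  shows "realizable k u"
proof -
  let ?n = "Suc k"
  define N where "N = ?n + 2"
  have N: "N \<noteq> 0" by (simp add: N_def)
  define colour where "colour b = to_nat_on B b mod N" for b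
  define C where "C i = {b \<in> B. colour b = i}" for i
  have C: "infinite (C i)" if i: "i < N" for i
  proof -
    let ?f = "\<lambda>m. from_nat_into B (m * N + i)"
    have bij: "bij_betw (from_nat_into B) UNIV B" using cB iB by (rule bij_betw_from_nat_into)
    have "inj ?f"
    proof (rule injI)
      fix x y assume "?f x = ?f y"
      then have "x * N + i = y * N + i"
        using bij by (auto simp: bij_betw_def dest: injD)
      then show "x = y" using N by simp
    qed
    moreover have "range ?f \<subseteq> C i"
      using i cB iB bij by (auto simp: C_def colour_def bij_betw_def to_nat_on_from_nat_into_infinite)
    ultimately show ?thesis using infinite_super range_inj_infinite by blast
  qed
  (* A family with values in W b i is supported outside the colour class C i and avoids it. *)
  define W where "W b i = (if b \<in> C i then {\<zero>} else lspan (words (replicate ?n (B - C i))))" for b i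
  have rep: "\<forall>S\<in>set (replicate ?n (B - A)). S \<subseteq> carrier L" for A
    using basis_subset by auto
  have W_subspace: "subspace (W b i)" for b i
    using lspan_subspace[OF words_carrier[OF rep]] subspace_zero
    by (simp add: W_def del: words.simps replicate.simps)
  have W_gam: "W b i \<subseteq> gam k" for b i
    using lspan_minimal[OF words_gam[OF rep] gam_subspace]
    by (simp add: W_def del: words.simps replicate.simps)
  have W_real: "realizable k w" if i: "i < N" and w: "\<And>b. b \<in> B \<Longrightarrow> w b \<in> W b i" for i w
  proof (rule realizable_words[OF k cB _ C[OF i], where Rs = "[]"])
    show "\<forall>S\<in>set (replicate ?n (B - C i) @ []). S \<subseteq> B - C i" by simp
    show "length (replicate ?n (B - C i) @ []) = Suc k" by simp
    show "\<forall>y\<in>B - C i. w y \<in> lspan (words (replicate ?n (B - C i) @ []))"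
    proof
      fix y assume y: "y \<in> B - C i"
      then show "w y \<in> lspan (words (replicate ?n (B - C i) @ []))"
        using w[of y] by (simp add: W_def del: words.simps replicate.simps)
    qed
    show "\<forall>b\<in>B - (B - C i). w b = \<zero>"
    proof
      fix b assume "b \<in> B - (B - C i)"
      then show "w b = \<zero>" using w[of b] by (simp add: W_def del: words.simps replicate.simps)
    qed
  qed (auto simp: C_def)
  have words_W: "lspan (words (replicate ?n B)) \<subseteq> subspace_sum (W b) N" if b: "b \<in> B" for b
  proof (rule lspan_minimal[OF _ subspace_sum_subspace[OF W_subspace]])
    show "words (replicate ?n B) \<subseteq> subspace_sum (W b) N"
    proof
      fix x assume "x \<in> words (replicate ?n B)"
      then obtain D where D: "D \<subseteq> B" "finite D" "card D \<le> ?n" "x \<in> words (replicate ?n D)"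
        using words_finite_support by blast
      have "card (colour ` insert b D) < card {..<N}"
        using card_image_le[of "insert b D" colour] D card_insert_le_m1[of ?n D b]
        by (simp add: N_def card_insert_if del: image_insert split: if_splits)
      then have "\<not> {..<N} \<subseteq> colour ` insert b D"
        using D by (meson card_mono finite_imageI finite_insert not_le)
      then obtain i where i: "i < N" "i \<notin> colour ` insert b D" by auto
      have "D \<subseteq> B - C i" using D(1) i by (auto simp: C_def)
      then have "words (replicate ?n D) \<subseteq> words (replicate ?n (B - C i))"
        by (intro words_mono) (simp add: list_all2_conv_all_nth del: replicate.simps)
      then have "x \<in> lspan (words (replicate ?n (B - C i)))" using D(4) by (intro hull_inc) blast
      moreover have "b \<notin> C i" using i by (auto simp: C_def)
      ultimately have "x \<in> W b i" by (simp add: W_def del: words.simps replicate.simps)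
      then show "x \<in> subspace_sum (W b) N"
        using subspace_sum_summand[of N "W b" i, OF W_subspace i(1)] by blast
    qed
  qed
  have "\<forall>b\<in>B. \<exists>s\<in>lspan (words (replicate ?n B)). cong_mod (gam (Suc k)) (u b) s"
    using gam_generated_by_words u by blast
  then obtain s where s: "\<And>b. b \<in> B \<Longrightarrow> s b \<in> lspan (words (replicate ?n B))"
    "\<And>b. b \<in> B \<Longrightarrow> cong_mod (gam (Suc k)) (u b) (s b)" by metis
  have "(\<forall>b\<in>B. s b \<in> gam k) \<and> realizable k s"
  proof (rule realizable_subspace_sum[OF k])
    show "W b i \<subseteq> gam k" for b i by (rule W_gam)
    show "realizable k w" if "i < N" "\<And>b. b \<in> B \<Longrightarrow> w b \<in> W b i" for i w
      using that by (rule W_real)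
    show "s b \<in> subspace_sum (W b) N" if "b \<in> B" for b
      using words_W[OF that] s(1)[OF that] by blast
  qed
  then have "realizable k s" ..
  then show ?thesis using s(2) by (rule realizable_cong)
qed


section \<open>Approximating endomorphisms by automorphisms\<close>

text \<open>If \<open>\<phi>\<close> agrees with \<open>f\<close> modulo one term of the series, then \<open>\<phi>\<inverse> f\<close> differs from the identity by
  a family with values in that term; composing \<open>\<phi>\<close> with an automorphism that realizes the family gains
  one step.\<close>

lemma lift_modulo_gam:
  assumes cB: "countable B" and iB: "infinite B" and f: "f \<in> lie_end L"
    and p: "p \<in> lie_aut L" "\<And>b. b \<in> B \<Longrightarrow> cong_mod (gam (Suc 0)) (p b) (f b)"
  shows "\<exists>\<phi>\<in>lie_aut L. \<forall>b\<in>B. cong_mod (gam (Suc k)) (\<phi> b) (f b)"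
proof (induction k)
  case 0
  then show ?case using p by blast
next
  case (Suc k)
  note G = gam_subspace
  from Suc obtain \<phi> where \<phi>: "\<phi> \<in> lie_aut L" "\<And>b. b \<in> B \<Longrightarrow> cong_mod (gam (Suc k)) (\<phi> b) (f b)"
    by blast
  from lie_aut_inverse[OF \<phi>(1)] obtain \<psi> where \<psi>: "\<psi> \<in> lie_aut L"
    "\<forall>x\<in>carrier L. \<psi> (\<phi> x) = x \<and> \<phi> (\<psi> x) = x" by blast
  note E = lie_autD(1)[OF \<phi>(1)] lie_autD(1)[OF \<psi>(1)]
  define u where "u b = \<psi> (f b) \<oplus> \<ominus> b" for b
  have bu: "b \<oplus> u b = \<psi> (f b)" if "b \<in> B" for b
    using M.a_lcomm[of b "\<psi> (f b)" "\<ominus> b"] that E f by (simp add: u_def M.r_neg)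
  have u: "u b \<in> gam (Suc k)" if b: "b \<in> B" for b
  proof -
    have "cong_mod (gam (Suc k)) (\<psi> (f b)) b"
      using end_cong_gam[OF cong_mod_sym[OF G \<phi>(2)[OF b]] E(2)] \<psi>(2) b by simp
    from cong_mod_add[OF G this cong_mod_refl[OF G, of "\<ominus> b"]]
    show ?thesis using b by (simp add: u_def M.r_neg cong_mod_zero_iff[OF G])
  qed
  have "realizable (Suc k) u" by (rule realizable_all[OF cB iB]) (use u in auto)
  then obtain \<theta> where \<theta>: "\<theta> \<in> lie_aut L"
    "\<And>b. b \<in> B \<Longrightarrow> cong_mod (gam (Suc (Suc k))) (\<theta> b) (b \<oplus> u b)"
    unfolding realizable_def by blast
  have "cong_mod (gam (Suc (Suc k))) ((\<phi> \<circ> \<theta>) b) (f b)" if b: "b \<in> B" for b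
    using end_cong_gam[OF \<theta>(2)[OF b] E(1)] \<psi>(2) b f by (simp add: bu)
  then show ?case using lie_aut_comp[OF \<phi>(1) \<theta>(1)] by blast
qed

section \<open>Linear parts\<close>

text \<open>The endomorphism \<open>coord b\<close> keeps \<open>b\<close> and kills the other generators. It maps \<open>L\<close> onto the
  line spanned by \<open>b\<close>, and so it reads off a coordinate of the linear part of an element.\<close>

definition coord :: "'a \<Rightarrow> 'a \<Rightarrow> 'a"
  where "coord b = free_end (\<lambda>c. if c = b then b else \<zero>)"

lemma
  assumes "b \<in> B"
  shows coord_end: "coord b \<in> lie_end L"
    and coord_self: "coord b b = b"
    and coord_other: "c \<in> B \<Longrightarrow> c \<noteq> b \<Longrightarrow> coord b c = \<zero>"
  using free_end[of "\<lambda>c. if c = b then b else \<zero>"] assms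
    free_end_basis[of "\<lambda>c. if c = b then b else \<zero>"]
  by (auto simp: coord_def)

lemma coord_multiple:
  assumes b: "b \<in> B" and x: "x \<in> carrier L"
  shows "\<exists>c. coord b x = c \<odot> b"
proof -
  note E = coord_end[OF b]
  have bc: "b \<in> carrier L" using b by simp
  have "carrier L \<subseteq> {x \<in> carrier L. \<exists>c. coord b x = c \<odot> b}" (is "_ \<subseteq> ?W")
  proof (rule subalgebra_containing_basis)
    show "subspace ?W"
    proof (rule subspaceI)
      show "\<zero> \<in> ?W" using smult_0[OF bc] by (auto simp: E intro!: exI[of _ 0])
      show "x \<oplus> y \<in> ?W" if "x \<in> ?W" "y \<in> ?W" for x y
        using that by (auto simp: end_add[OF E] smult_add_left[OF bc, symmetric])
      show "k \<odot> x \<in> ?W" if "x \<in> ?W" for k x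
        using that by (auto simp: end_smult[OF E] smult_smult[OF bc, symmetric])
    qed blast
    show "x \<otimes> y \<in> ?W" if "x \<in> ?W" "y \<in> ?W" for x y
      using that bc
      by (auto simp: end_bracket[OF E] bracket_smult_left bracket_smult_right bracket_self smult_0
          intro!: exI[of _ 0])
    show "B \<subseteq> ?W"
    proof
      fix a assume "a \<in> B"
      then have "coord b a = (if a = b then 1 else 0) \<odot> b"
        using coord_self[OF b] coord_other[OF b, of a] smult_0[OF bc] smult_1[OF bc] by simp
      then have "\<exists>c. coord b a = c \<odot> b" by (rule exI)
      then show "a \<in> ?W" using \<open>a \<in> B\<close> by simp
    qed
  qed
  then show ?thesis using x by blast
qed

lemma coord_derived:
  assumes b: "b \<in> B" and x: "x \<in> gam (Suc 0)"
  shows "coord b x = \<zero>"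
proof -
  note E = coord_end[OF b]
  have "gam (Suc 0) \<subseteq> {x \<in> carrier L. coord b x = \<zero>}" (is "_ \<subseteq> ?W")
  proof (rule gam_Suc_minimal)
    show "subspace ?W"
      by (rule subspaceI) (auto simp: E end_add[OF E] end_smult[OF E])
    fix x y assume "x \<in> gam 0" "y \<in> carrier L"
    then have c: "x \<in> carrier L" "y \<in> carrier L" by simp_all
    obtain k l where "coord b x = k \<odot> b" "coord b y = l \<odot> b"
      using coord_multiple[OF b] c by blast
    then show "x \<otimes> y \<in> ?W" using c b
      by (simp add: end_bracket[OF E] bracket_smult_left bracket_smult_right bracket_self)
  qed
  then show ?thesis using x by blast
qed

lemma lspan_finite_support:
  assumes "s \<in> lspan B"
  shows "\<exists>F\<subseteq>B. finite F \<and> s \<in> lspan F"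
  using assms basis_subset
proof (induction rule: lspan_induct)
  case (gen x)
  then show ?case by (intro exI[of _ "{x}"]) (auto intro: hull_inc)
next
  case zero
  then show ?case using subspaceD(2)[OF lspan_subspace[of "{}"]] by blast
next
  case (add x y)
  then obtain F G where FG: "F \<subseteq> B" "finite F" "x \<in> lspan F" "G \<subseteq> B" "finite G" "y \<in> lspan G" by blast
  then have "x \<in> lspan (F \<union> G)" "y \<in> lspan (F \<union> G)" by (auto intro: lspan_mono[rotated])
  moreover have "F \<union> G \<subseteq> carrier L" using FG basis_subset by blast
  ultimately have "x \<oplus> y \<in> lspan (F \<union> G)" using subspaceD(3)[OF lspan_subspace] by blast
  then show ?case using FG by (intro exI[of _ "F \<union> G"]) auto
next
  case (smult c x)
  then obtain F where F: "F \<subseteq> B" "finite F" "x \<in> lspan F" by blast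
  then have "c \<odot> x \<in> lspan F" using subspaceD(4)[OF lspan_subspace, of F x c] basis_subset by blast
  then show ?case using F by blast
qed

lemma lspan_basis_eq_zero:
  assumes "s \<in> lspan B" "\<And>b. b \<in> B \<Longrightarrow> coord b s = \<zero>"
  shows "s = \<zero>"
proof -
  obtain F where F: "finite F" "F \<subseteq> B" "s \<in> lspan F" using lspan_finite_support[OF assms(1)] by blast
  have "\<lbrakk>F \<subseteq> B; s \<in> lspan F; \<forall>b\<in>F. coord b s = \<zero>\<rbrakk> \<Longrightarrow> s = \<zero>" for s
    using F(1)
  proof (induction F arbitrary: s)
    case empty
    then show ?case using lspan_minimal[OF _ subspace_zero, of "{}"] by auto
  next
    case (insert b F)
    then have b: "b \<in> B" and bc: "b \<in> carrier L" and FB: "F \<subseteq> B" by auto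
    have Fc: "F \<subseteq> carrier L" and iFc: "insert b F \<subseteq> carrier L" using bc FB basis_subset by auto
    note S = lspan_subspace[OF Fc] and sc = lspan_carrier[OF Fc]
    have "\<exists>c. \<exists>t\<in>lspan F. s = c \<odot> b \<oplus> t"
      using insert.prems(2) iFc
    proof (induction rule: lspan_induct)
      case (gen x)
      show ?case
      proof (cases "x = b")
        case True
        then show ?thesis using subspaceD(2)[OF S] bc
          by (intro exI[of _ 1] bexI[of _ \<zero>]) (auto simp: smult_1)
      next
        case False
        then have "x \<in> F" using gen by simp
        then have "x \<in> lspan F" "x \<in> carrier L" using Fc by (auto intro: hull_inc)
        then show ?thesis using bc
          by (intro exI[of _ 0] bexI[of _ x]) (auto simp: smult_0)
      qed
    next
      case zero
      then show ?case using subspaceD(2)[OF S] bc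
        by (intro exI[of _ 0] bexI[of _ \<zero>]) (auto simp: smult_0)
    next
      case (add x y)
      then obtain c t d r where *: "t \<in> lspan F" "x = c \<odot> b \<oplus> t" "r \<in> lspan F" "y = d \<odot> b \<oplus> r"
        by blast
      then have "x \<oplus> y = (c + d) \<odot> b \<oplus> (t \<oplus> r)"
        using bc sc by (simp add: smult_add_left M.a_ac)
      then show ?case using subspaceD(3)[OF S] * by blast
    next
      case (smult k x)
      then obtain c t where *: "t \<in> lspan F" "x = c \<odot> b \<oplus> t" by blast
      then have "k \<odot> x = (k * c) \<odot> b \<oplus> k \<odot> t"
        using bc sc by (simp add: smult_add_right smult_smult)
      then show ?case using subspaceD(4)[OF S] * by blast
    qed
    then obtain c t where ct: "t \<in> lspan F" "s = c \<odot> b \<oplus> t" by blast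
    have tc: "t \<in> carrier L" using sc ct by simp
    have "coord b t = \<zero>"
      using ct(1) Fc
    proof (induction rule: lspan_induct)
      case (gen x)
      then show ?case using coord_other[OF b, of x] insert.hyps(2) FB by auto
    qed (auto simp: coord_end[OF b] end_add end_smult sc)
    then have "coord b s = c \<odot> b"
      using ct tc bc by (simp add: coord_end[OF b] end_add end_smult coord_self[OF b])
    then have "s = t" using insert.prems(3) ct(2) tc by simp
    then show ?case using insert.IH[OF FB] ct(1) insert.prems(3) by auto
  qed
  then show ?thesis using F assms(2) by blast
qed

lemma lspan_basis_cong_eq:
  assumes s: "s \<in> lspan B" and t: "t \<in> lspan B" and cong: "cong_mod (gam (Suc 0)) s t"
  shows "s = t"
proof -
  note S = lspan_subspace[OF basis_subset]
  have c: "s \<in> carrier L" "t \<in> carrier L" using s t lspan_carrier[OF basis_subset] by auto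
  have "s \<oplus> \<ominus> t \<in> lspan B" using subspaceD(3,5)[OF S] s t by blast
  moreover have "s \<oplus> \<ominus> t \<in> gam (Suc 0)"
    using cong_mod_add[OF gam_subspace cong cong_mod_refl[OF gam_subspace, of "\<ominus> t"]] c
    by (simp add: M.r_neg cong_mod_zero_iff[OF gam_subspace])
  ultimately have "s \<oplus> \<ominus> t = \<zero>" using lspan_basis_eq_zero coord_derived by blast
  then show ?thesis using c by (metis M.minus_equality M.minus_minus M.a_inv_closed)
qed

text \<open>Replace \<open>f b\<close> and \<open>f' b\<close> by their linear parts. The resulting endomorphisms \<open>p\<close> and \<open>q\<close> preserve
  the span of \<open>B\<close>, and they are inverse to each other modulo the derived algebra, which meets
  this span in zero; so they are inverse to each other.\<close>

lemma linear_lift: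
  assumes f: "f \<in> lie_end L" "f' \<in> lie_end L"
    and inv: "\<And>b. b \<in> B \<Longrightarrow> cong_mod (gam (Suc 0)) (f (f' b)) b"
      "\<And>b. b \<in> B \<Longrightarrow> cong_mod (gam (Suc 0)) (f' (f b)) b"
  shows "\<exists>p\<in>lie_aut L. \<forall>b\<in>B. cong_mod (gam (Suc 0)) (p b) (f b)"
proof -
  note G = gam_subspace[of "Suc 0"]
  have lin: "\<exists>p. p \<in> lie_end L \<and> p ` lspan B \<subseteq> lspan B \<and> (\<forall>b\<in>B. cong_mod (gam (Suc 0)) (p b) (f b))"
    if f: "f \<in> lie_end L" for f
  proof -
    have "\<forall>b\<in>B. \<exists>s\<in>lspan B. cong_mod (gam (Suc 0)) (f b) s"
      using linear_part f by (metis basis_carrier end_closed)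
    then obtain s where s: "\<And>b. b \<in> B \<Longrightarrow> s b \<in> lspan B"
      "\<And>b. b \<in> B \<Longrightarrow> cong_mod (gam (Suc 0)) (f b) (s b)" by metis
    have "s b \<in> carrier L" if "b \<in> B" for b using s(1)[OF that] lspan_carrier[OF basis_subset] by blast
    note fe = free_end[OF this] free_end_basis[OF this]
    have "free_end s ` lspan B = lspan (free_end s ` B)" by (rule lspan_image_end[OF fe(1) basis_subset])
    also have "\<dots> \<subseteq> lspan B"
      using s(1) fe(2) by (intro lspan_minimal lspan_subspace basis_subset) auto
    finally show ?thesis using fe s(2) cong_mod_sym[OF G] by (intro exI[of _ "free_end s"]) auto
  qed
  obtain p where p: "p \<in> lie_end L" "p ` lspan B \<subseteq> lspan B"
    "\<And>b. b \<in> B \<Longrightarrow> cong_mod (gam (Suc 0)) (p b) (f b)" using lin[OF f(1)] by blast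
  obtain q where q: "q \<in> lie_end L" "q ` lspan B \<subseteq> lspan B"
    "\<And>b. b \<in> B \<Longrightarrow> cong_mod (gam (Suc 0)) (q b) (f' b)" using lin[OF f(2)] by blast
  have inverse: "p (q b) = b"
    if b: "b \<in> B" and p: "p \<in> lie_end L" "p ` lspan B \<subseteq> lspan B"
      "\<And>b. b \<in> B \<Longrightarrow> cong_mod (gam (Suc 0)) (p b) (f b)"
    and q: "q \<in> lie_end L" "q ` lspan B \<subseteq> lspan B"
      "\<And>b. b \<in> B \<Longrightarrow> cong_mod (gam (Suc 0)) (q b) (f' b)"
    and f: "f \<in> lie_end L" and inv: "cong_mod (gam (Suc 0)) (f (f' b)) b" for p q f f' b
  proof (rule lspan_basis_cong_eq)
    show bB: "b \<in> lspan B" using b by (rule hull_inc)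
    then show "p (q b) \<in> lspan B" using p(2) q(2) by blast
    have "cong_mod (gam (Suc 0)) (p (q b)) (f (q b))"
      using end_cong_derived[OF p(1) f p(3)] q(1) b by simp
    also have "cong_mod (gam (Suc 0)) (f (q b)) (f (f' b))"
      using end_cong_gam[OF q(3)[OF b] f] .
    also (cong_mod_trans[OF G]) note inv
    finally (cong_mod_trans[OF G]) show "cong_mod (gam (Suc 0)) (p (q b)) b" .
  qed
  have "p \<in> lie_aut L"
    by (rule lie_autI[OF p(1) q(1)])
      (use inverse[OF _ p q f(1) inv(1)] inverse[OF _ q p f(2) inv(2)] in auto)
  then show ?thesis using p(3) by blast
qed

text \<open>If \<open>v \<in> V\<close> has a nonzero coordinate at \<open>b\<close>, then \<open>coord b v \<in> V\<close> gives \<open>b \<in> V\<close>, and sending \<open>b\<close>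
  to an arbitrary \<open>x\<close> gives \<open>x \<in> V\<close>.\<close>

lemma fully_invariant_subset_derived:
  assumes V: "lie_ideal V L" "V \<noteq> carrier L" "fully_invariant V L"
  shows "V \<subseteq> gam (Suc 0)"
proof
  fix v assume v: "v \<in> V"
  note S = lspan_subspace[OF basis_subset] and G = gam_subspace[of "Suc 0"]
  have VS: "subspace V" using V(1) by (simp add: lie_ideal_def)
  have vc: "v \<in> carrier L" using v subspaceD(1)[OF VS] by blast
  obtain s where s: "s \<in> lspan B" "cong_mod (gam (Suc 0)) v s" using linear_part[OF vc] .
  have "coord b s = \<zero>" if b: "b \<in> B" for b
  proof -
    note E = coord_end[OF b]
    have bc: "b \<in> carrier L" using b by simp
    from s(2) obtain w where w: "w \<in> gam (Suc 0)" "v = s \<oplus> w" and sc: "s \<in> carrier L"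
      by (auto simp: cong_mod_def)
    then have vs: "coord b v = coord b s"
      using coord_derived[OF b w(1)] E by (simp add: end_add)
    have vV: "coord b v \<in> V" using V(3) E v by (auto simp: fully_invariant_def)
    obtain c where c: "coord b v = c \<odot> b" using coord_multiple[OF b vc] by blast
    have "c = 0"
    proof (rule ccontr)
      assume "c \<noteq> 0"
      then have "b = inverse c \<odot> (c \<odot> b)" using bc by (simp flip: smult_smult add: smult_1)
      also have "\<dots> \<in> V" using subspaceD(4)[OF VS] vV c by simp
      finally have bV: "b \<in> V" .
      have "x \<in> V" if x: "x \<in> carrier L" for x
      proof -
        have "free_end (\<lambda>_. x) \<in> lie_end L" "free_end (\<lambda>_. x) b = x"
          using free_end[of "\<lambda>_. x"] free_end_basis[of "\<lambda>_. x"] x b by auto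
        then have "x \<in> free_end (\<lambda>_. x) ` V" using bV by (auto intro: rev_image_eqI)
        then show ?thesis
          using V(3) \<open>free_end (\<lambda>_. x) \<in> lie_end L\<close> unfolding fully_invariant_def by (auto dest: bspec)
      qed
      then show False using V(2) subspaceD(1)[OF VS] by blast
    qed
    then show ?thesis using vs c smult_0[OF bc] by simp
  qed
  then have "s = \<zero>" using lspan_basis_eq_zero s(1) by blast
  then show "v \<in> gam (Suc 0)" using s(2) cong_mod_zero_iff[OF G] by simp
qed

section \<open>Lifting along the quotient map\<close>

lemma lie_proj_eq_iff:
  assumes V: "lie_ideal V L" and x: "x \<in> carrier L" and y: "y \<in> carrier L"
  shows "lie_proj L V x = lie_proj L V y \<longleftrightarrow> cong_mod V x y"
proof -
  interpret Q: lie_algebra "lie_quot L V" by (rule lie_quot_lie_algebra[OF lie_algebra_axioms V])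
  note H = lie_proj_hom[OF lie_algebra_axioms V]
  have VS: "subspace V" using V by (simp add: lie_ideal_def)
  have c: "lie_proj L V z \<in> carrier (lie_quot L V)" if "z \<in> carrier L" for z
    using lie_hom_closed[OF H that] .
  note zero = lie_proj_eq_zero_iff[OF lie_algebra_axioms V]
  show ?thesis
  proof
    assume eq: "lie_proj L V x = lie_proj L V y"
    let ?z = "\<ominus> y \<oplus> x"
    have "lie_proj L V y \<oplus>\<^bsub>lie_quot L V\<^esub> lie_proj L V ?z = lie_proj L V (y \<oplus> ?z)"
      using x y by (simp add: lie_hom_add[OF H])
    also have "y \<oplus> ?z = x" using x y by (simp add: M.a_assoc[symmetric] M.r_neg)
    finally have "lie_proj L V ?z = \<zero>\<^bsub>lie_quot L V\<^esub>"
      using eq c x y by (metis Q.M.add.r_cancel_one' M.a_inv_closed M.a_closed Q.M.a_comm)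
    then have "?z \<in> V" using zero x y by simp
    then show "cong_mod V x y" using \<open>y \<oplus> ?z = x\<close> x y unfolding cong_mod_def by metis
  next
    assume "cong_mod V x y"
    then obtain w where w: "w \<in> V" "x = y \<oplus> w" by (auto simp: cong_mod_def)
    then have "w \<in> carrier L" using subspaceD(1)[OF VS] by blast
    then show "lie_proj L V x = lie_proj L V y"
      using w zero c y by (simp add: lie_hom_add[OF H])
  qed
qed

lemma lower_central_subset_of_nilpotent_quotient:
  assumes V: "lie_ideal V L" and nil: "lie_nilpotent (lie_quot L V)"
  shows "\<exists>n. gam (Suc n) \<subseteq> V"
proof -
  note Q = lie_quot_lie_algebra[OF lie_algebra_axioms V] and H = lie_proj_hom[OF lie_algebra_axioms V]
  obtain n where n: "lower_central (lie_quot L V) n = {\<zero>\<^bsub>lie_quot L V\<^esub>}"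
    using nil unfolding lie_nilpotent_def by blast
  have "gam n \<subseteq> V"
    using lie_hom_lower_central[OF Q H, of _ n] n lie_proj_eq_zero_iff[OF lie_algebra_axioms V] by auto
  then show ?thesis using gam_Suc_subset by blast
qed

lemma lift_of_quotient_end:
  assumes V: "lie_ideal V L" and a: "\<alpha> \<in> lie_end (lie_quot L V)"
  shows "\<exists>f\<in>lie_end L. \<forall>x\<in>carrier L. lie_proj L V (f x) = \<alpha> (lie_proj L V x)"
proof -
  note Q = lie_quot_lie_algebra[OF lie_algebra_axioms V] and H = lie_proj_hom[OF lie_algebra_axioms V]
  have "\<forall>b\<in>B. \<exists>y\<in>carrier L. lie_proj L V y = \<alpha> (lie_proj L V b)"
    using lie_hom_closed[OF a] lie_hom_closed[OF H] lie_quot_carrier[OF lie_algebra_axioms V]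
    by (metis basis_carrier imageE)
  then obtain y where y: "\<And>b. b \<in> B \<Longrightarrow> y b \<in> carrier L"
    "\<And>b. b \<in> B \<Longrightarrow> lie_proj L V (y b) = \<alpha> (lie_proj L V b)" by metis
  note fe = free_end[OF y(1)] free_end_basis[OF y(1)]
  have "(lie_proj L V \<circ> free_end y) x = (\<alpha> \<circ> lie_proj L V) x" if "x \<in> carrier L" for x
    using hom_ext[OF Q lie_hom_comp[OF fe(1) H] lie_hom_comp[OF H a] _ that] fe(2) y by simp
  then show ?thesis using fe(1) by (intro bexI[of _ "free_end y"]) auto
qed

end

theorem corollary1:
  fixes L :: "('k::field_char_0, 'a) module"
    and B V :: "'a set"
    and \<alpha> :: "'a set \<Rightarrow> 'a set"
  assumes "lie_algebra L"
    and "free_lie_basis L B" and "countable B" and "infinite B"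
    and "lie_ideal V L" and "V \<noteq> carrier L" and "fully_invariant V L"
    and "lie_nilpotent (lie_quot L V)"
    and "\<alpha> \<in> lie_aut (lie_quot L V)"
  shows "\<exists>\<phi>\<in>lie_aut L. \<forall>x\<in>carrier L. lie_proj L V (\<phi> x) = \<alpha> (lie_proj L V x)"
proof -
  interpret free_lie_algebra L B
    using assms by (intro free_lie_algebra.intro free_lie_algebra_axioms.intro)
  note V = \<open>lie_ideal V L\<close>
  note Q = lie_quot_lie_algebra[OF lie_algebra_axioms V] and H = lie_proj_hom[OF lie_algebra_axioms V]
  note \<alpha> = lie_autD(1)[OF \<open>\<alpha> \<in> lie_aut (lie_quot L V)\<close>]
  obtain \<beta> where \<beta>: "\<beta> \<in> lie_aut (lie_quot L V)"
    "\<forall>x\<in>carrier (lie_quot L V). \<beta> (\<alpha> x) = x \<and> \<alpha> (\<beta> x) = x"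
    using lie_algebra.lie_aut_inverse[OF Q assms(9)] by blast
  obtain f where f: "f \<in> lie_end L" "\<forall>x\<in>carrier L. lie_proj L V (f x) = \<alpha> (lie_proj L V x)"
    using lift_of_quotient_end[OF V \<alpha>] by blast
  obtain f' where f': "f' \<in> lie_end L" "\<forall>x\<in>carrier L. lie_proj L V (f' x) = \<beta> (lie_proj L V x)"
    using lift_of_quotient_end[OF V lie_autD(1)[OF \<beta>(1)]] by blast
  have "cong_mod (gam (Suc 0)) (f (f' b)) b" "cong_mod (gam (Suc 0)) (f' (f b)) b" if b: "b \<in> B" for b
  proof -
    have bc: "b \<in> carrier L" using b by simp
    have "lie_proj L V (f (f' b)) = lie_proj L V b" "lie_proj L V (f' (f b)) = lie_proj L V b"
      using f f' \<beta>(2) lie_hom_closed[OF H bc] bc by simp_all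
    then have "cong_mod V (f (f' b)) b" "cong_mod V (f' (f b)) b"
      using lie_proj_eq_iff[OF V] f(1) f'(1) bc by simp_all
    then show "cong_mod (gam (Suc 0)) (f (f' b)) b" "cong_mod (gam (Suc 0)) (f' (f b)) b"
      using cong_mod_mono fully_invariant_subset_derived[OF V assms(6,7)] by blast+
  qed
  from linear_lift[OF f(1) f'(1) this]
  obtain p where p: "p \<in> lie_aut L" "\<And>b. b \<in> B \<Longrightarrow> cong_mod (gam (Suc 0)) (p b) (f b)" by blast
  obtain n where n: "gam (Suc n) \<subseteq> V"
    using lower_central_subset_of_nilpotent_quotient[OF V] assms by blast
  obtain \<phi> where \<phi>: "\<phi> \<in> lie_aut L" "\<And>b. b \<in> B \<Longrightarrow> cong_mod (gam (Suc n)) (\<phi> b) (f b)"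
    using lift_modulo_gam[OF assms(3,4) f(1) p, of n] by blast
  note \<phi>E = lie_autD(1)[OF \<phi>(1)]
  have "lie_proj L V (\<phi> b) = lie_proj L V (f b)" if "b \<in> B" for b
    using cong_mod_mono[OF \<phi>(2)[OF that] n] lie_proj_eq_iff[OF V] \<phi>E f(1) that by simp
  then have "(lie_proj L V \<circ> \<phi>) x = (lie_proj L V \<circ> f) x" if "x \<in> carrier L" for x
    using hom_ext[OF Q lie_hom_comp[OF \<phi>E H] lie_hom_comp[OF f(1) H] _ that] by simp
  then show ?thesis using \<phi>(1) f(2) by auto
qed

end
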